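(* Consider scheduling with uncertain processing times on $m\ge1$ machines with the objective of minimizing the total completion time, and let $\beta>0$. For a job $k$ let $\mathbb P_k\in[0,1]$ denote the probability with which the algorithm $\beta$-RPCPM tests $k$, let $p_k^*=\min\{u_k,t_k+p_k\}$, and let $$R=\max_k\frac{(1+\frac1\beta)\,u_k\,(1-\mathbb P_k)+\max\{2t_k+p_k,\ \beta t_k,\ (1+\frac1\beta)(t_k+p_k)\}\,\mathbb P_k}{p_k^*},$$ $$r=\max_j\frac{u_j(1-\mathbb P_j)+(t_j+p_j)\mathbb P_j}{p_j^*},$$ where the maxima (suprema, assumed finite) are over all possible jobs, i.e. all triples $(t,u,p)$ with $t,u>0$ and $p\in[0,u]$. If $R\le 2r$, then the expected competitive ratio of $\beta$-RPCPM is at most $$R\left(\frac12+\frac1{2m}\right)+r\left(1-\frac1m\right).$$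
   Context: Problem. There are $n$ jobs, all available at time $0$, and $m$ identical machines, each of which runs one task at a time. Job $j$ has a testing time $t_j> 0$, an upper limit $u_j> 0$, and a real processing time $p_j\in[0,u_j]$. A job may be executed untested, which takes $u_j$ time units, or it may be tested (taking $t_j$ time units) and afterwards, once the test is finished, executed in $p_j$ time units; other tasks may run between the test and the execution, and the test and the execution of a job may be on different machines. The completion time of a job is the time at which its execution (or execution-untested) ends, and the cost of a schedule is the sum of the completion times of all jobs. An online algorithm knows all $t_j,u_j$ from the start, but learns $p_j$ only when the test of $j$ is finished. $\mathrm{OPT}$ knows all $p_j$ in advance (but must still test $j$ in order to run it in time $p_j$), and its cost is the minimum cost of any schedule; it spends $p_j^*=\min\{u_j,t_j+p_j\}$ on job $j$ and runs jobs in non-decreasing order of $p_j^*$ whenever a machine is available. The expected competitive ratio of a randomized online algorithm $A$ is the smallest $c$ such that $\mathbb E[\mathrm{cost}(A)]\le c\cdot\mathrm{cost}(\mathrm{OPT})$ on all instances. Algorithm $\beta$-RPCPM. The testing probability $\mathbb P_j\in[0,1]$ of job $j$ is a function of $u_j,t_j,\beta$, with $\mathbb P_j=0$ if $u_j/t_j<1$ and $\mathbb P_j=1$ if $u_j/t_j>3$. Maintain a priority queue of tasks, smaller weight meaning higher priority (ties broken arbitrarily). Initially, for each job $j$, independently: with probability $\mathbb P_j$ insert a testing task of weight $\beta t_j$ (job $j$ is tested), and with probability $1-\mathbb P_j$ insert an execution-untested task of weight $u_j$ (job $j$ is not tested). All machines are idle at time $0$. Whenever a machine becomes idle: if the task it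 has just finished was the testing task of a job $i$, insert the execution task of $i$ (of duration $p_i$) with weight $t_i+p_i$ into the queue; then extract a task of smallest weight from the queue (if it is nonempty) and run it, without interruption, on this machine. *)

theory Defs
  imports "HOL-Probability.Probability" "HOL-Probability.Product_PMF"
begin

record job =
  test_time :: real
  upper_limit :: real
  proc_time :: real

definition valid_job :: "job \<Rightarrow> bool" where
  "valid_job J \<longleftrightarrow> test_time J > 0 \<and> upper_limit J > 0 \<and>
     0 \<le> proc_time J \<and> proc_time J \<le> upper_limit J"

definition opt_time :: "job \<Rightarrow> real" where
  "opt_time J = min (upper_limit J) (test_time J + proc_time J)"

type_synonym jobs = "job list"

definition valid_instance :: "jobs \<Rightarrow> bool" where
  "valid_instance I \<longleftrightarrow> (\<forall>J\<in>set I. valid_job J)"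


section \<open>Schedules and the optimum\<close>

text \<open>Jobs are referred to by their index in the instance. \<open>Exec j\<close> is the execution
  of \<open>j\<close> after its test, \<open>Untested j\<close> its execution without a test.\<close>

datatype task = Test nat | Exec nat | Untested nat

fun duration :: "jobs \<Rightarrow> task \<Rightarrow> real" where
  "duration I (Test j) = test_time (I ! j)"
| "duration I (Exec j) = proc_time (I ! j)"
| "duration I (Untested j) = upper_limit (I ! j)"

text \<open>A schedule maps each task that is run to its machine and its starting time.\<close>

type_synonym schedule = "task \<Rightarrow> (nat \<times> real) option"

definition machine_of :: "schedule \<Rightarrow> task \<Rightarrow> nat" where
  "machine_of \<sigma> x = fst (the (\<sigma> x))"

definition start_of :: "schedule \<Rightarrow> task \<Rightarrow> real" where
  "start_of \<sigma> x = snd (the (\<sigma> x))"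

definition end_of :: "jobs \<Rightarrow> schedule \<Rightarrow> task \<Rightarrow> real" where
  "end_of I \<sigma> x = start_of \<sigma> x + duration I x"

definition feasible_schedule :: "nat \<Rightarrow> jobs \<Rightarrow> schedule \<Rightarrow> bool" where
  "feasible_schedule m I \<sigma> \<longleftrightarrow>
     (\<exists>T \<subseteq> {..<length I}.
        dom \<sigma> = Test ` T \<union> Exec ` T \<union> Untested ` ({..<length I} - T)) \<and>
     (\<forall>x \<in> dom \<sigma>. machine_of \<sigma> x < m \<and> 0 \<le> start_of \<sigma> x) \<and>
     (\<forall>j. Test j \<in> dom \<sigma> \<longrightarrow> end_of I \<sigma> (Test j) \<le> start_of \<sigma> (Exec j)) \<and>
     (\<forall>x \<in> dom \<sigma>. \<forall>y \<in> dom \<sigma>. x \<noteq> y \<and> machine_of \<sigma> x = machine_of \<sigma> y \<longrightarrow>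
        end_of I \<sigma> x \<le> start_of \<sigma> y \<or> end_of I \<sigma> y \<le> start_of \<sigma> x)"

definition completion_time :: "jobs \<Rightarrow> schedule \<Rightarrow> nat \<Rightarrow> real" where
  "completion_time I \<sigma> j =
     (if Exec j \<in> dom \<sigma> then end_of I \<sigma> (Exec j) else end_of I \<sigma> (Untested j))"

definition cost :: "jobs \<Rightarrow> schedule \<Rightarrow> real" where
  "cost I \<sigma> = (\<Sum>j<length I. completion_time I \<sigma> j)"

definition opt_cost :: "nat \<Rightarrow> jobs \<Rightarrow> real" where
  "opt_cost m I = (INF \<sigma> \<in> {\<sigma>. feasible_schedule m I \<sigma>}. cost I \<sigma>)"

text \<open>A randomized algorithm yields, for each instance, a distribution of schedules. The infimum
  is taken in the extended reals, so that it is \<open>\<infinity>\<close> if no constant is admissible.\<close>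

definition expected_competitive_ratio :: "nat \<Rightarrow> (jobs \<Rightarrow> schedule pmf) \<Rightarrow> ereal" where
  "expected_competitive_ratio m A =
     Inf {ereal c | c. \<forall>I. valid_instance I \<longrightarrow>
            measure_pmf.expectation (A I) (cost I) \<le> c * opt_cost m I}"


section \<open>The algorithm\<close>

text \<open>The probability \<open>P u t\<close> of testing a job with upper limit \<open>u\<close> and testing time \<open>t\<close>;
  the parameter \<open>\<beta>\<close> is fixed throughout, so \<open>P\<close> may depend on it.\<close>

definition testing_probability :: "(real \<Rightarrow> real \<Rightarrow> real) \<Rightarrow> bool" where
  "testing_probability P \<longleftrightarrow> (\<forall>u t. u > 0 \<and> t > 0 \<longrightarrow>
     0 \<le> P u t \<and> P u t \<le> 1 \<and>
     (u / t < 1 \<longrightarrow> P u t = 0) \<and>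
     (u / t > 3 \<longrightarrow> P u t = 1))"

abbreviation job_prob :: "(real \<Rightarrow> real \<Rightarrow> real) \<Rightarrow> job \<Rightarrow> real" where
  "job_prob P J \<equiv> P (upper_limit J) (test_time J)"

fun weight :: "real \<Rightarrow> jobs \<Rightarrow> task \<Rightarrow> real" where
  "weight \<beta> I (Test j) = \<beta> * test_time (I ! j)"
| "weight \<beta> I (Exec j) = test_time (I ! j) + proc_time (I ! j)"
| "weight \<beta> I (Untested j) = upper_limit (I ! j)"

text \<open>In a state, \<open>machines s i = Some (x, f)\<close> means that machine \<open>i\<close> becomes idle at time \<open>f\<close>
  by finishing \<open>x\<close>, where \<open>x = None\<close> if it has not run any task yet; \<open>machines s i = None\<close> means
  that it found the queue empty when it last became idle. In the latter case it remains idle: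
  a task that is inserted later is inserted together with another machine becoming idle, which
  then extracts a task. A set suffices for the queue, as no task is inserted twice.\<close>

record state =
  machines :: "nat \<Rightarrow> (task option \<times> real) option"
  queue :: "task set"
  started :: schedule

definition initial_state :: "nat \<Rightarrow> jobs \<Rightarrow> nat set \<Rightarrow> state" where
  "initial_state m I T =
     \<lparr>machines = (\<lambda>i. if i < m then Some (None, 0) else None),
      queue = Test ` T \<union> Untested ` ({..<length I} - T),
      started = Map.empty\<rparr>"

fun released :: "task option \<Rightarrow> task set" where
  "released (Some (Test j)) = {Exec j}"
| "released _ = {}"

definition next_idle :: "state \<Rightarrow> nat \<Rightarrow> task option \<Rightarrow> real \<Rightarrow> bool" where
  "next_idle s i x f \<longleftrightarrow> machines s i = Some (x, f) \<and>
     (\<forall>i' x' f'. machines s i' = Some (x', f') \<longrightarrow> f \<le> f')"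

text \<open>One step handles one machine becoming idle. The choices among machines becoming idle at
  the same time and among queued tasks of the same weight are left open.\<close>

inductive step :: "real \<Rightarrow> jobs \<Rightarrow> state \<Rightarrow> state \<Rightarrow> bool" for \<beta> I where
  start: "next_idle s i x f \<Longrightarrow> Q = queue s \<union> released x \<Longrightarrow>
    y \<in> Q \<Longrightarrow> \<forall>z\<in>Q. weight \<beta> I y \<le> weight \<beta> I z \<Longrightarrow>
    step \<beta> I s
      \<lparr>machines = (machines s)(i \<mapsto> (Some y, f + duration I y)),
       queue = Q - {y},
       started = (started s)(y \<mapsto> (i, f))\<rparr>"
| stop: "next_idle s i x f \<Longrightarrow> queue s \<union> released x = {} \<Longrightarrow>
    step \<beta> I s (s\<lparr>machines := (machines s)(i := None)\<rparr>)"

definition RPCPM_schedules :: "nat \<Rightarrow> real \<Rightarrow> jobs \<Rightarrow> nat set \<Rightarrow> schedule set" where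
  "RPCPM_schedules m \<beta> I T =
     {started s | s. (step \<beta> I)\<^sup>*\<^sup>* (initial_state m I T) s \<and> (\<forall>i. machines s i = None)}"

text \<open>The set of tested jobs, each job being included independently.\<close>

definition tested_jobs :: "(real \<Rightarrow> real \<Rightarrow> real) \<Rightarrow> jobs \<Rightarrow> nat set pmf" where
  "tested_jobs P I =
     map_pmf Collect (Pi_pmf {..<length I} False (\<lambda>j. bernoulli_pmf (job_prob P (I ! j))))"

text \<open>\<open>A\<close> is the algorithm under some way \<open>K\<close> of breaking ties, which may be randomized.\<close>

definition is_RPCPM ::
  "nat \<Rightarrow> real \<Rightarrow> (real \<Rightarrow> real \<Rightarrow> real) \<Rightarrow> (jobs \<Rightarrow> schedule pmf) \<Rightarrow> bool" where
  "is_RPCPM m \<beta> P A \<longleftrightarrow> (\<forall>I. valid_instance I \<longrightarrow>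
     (\<exists>K. (\<forall>T \<in> set_pmf (tested_jobs P I). set_pmf (K T) \<subseteq> RPCPM_schedules m \<beta> I T) \<and>
          A I = bind_pmf (tested_jobs P I) K))"


section \<open>The two ratios of a single job\<close>

definition R_ratio :: "real \<Rightarrow> (real \<Rightarrow> real \<Rightarrow> real) \<Rightarrow> job \<Rightarrow> real" where
  "R_ratio \<beta> P J =
     (let t = test_time J; u = upper_limit J; p = proc_time J; q = job_prob P J in
      ((1 + 1 / \<beta>) * u * (1 - q) +
       Max {2 * t + p, \<beta> * t, (1 + 1 / \<beta>) * (t + p)} * q) / opt_time J)"

definition r_ratio :: "(real \<Rightarrow> real \<Rightarrow> real) \<Rightarrow> job \<Rightarrow> real" where
  "r_ratio P J =
     (let t = test_time J; u = upper_limit J; p = proc_time J; q = job_prob P J in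
      (u * (1 - q) + (t + p) * q) / opt_time J)"

end

theory Submission
  imports Defs
begin

text \<open>
  A queued task never has a smaller weight than a task that has already been started: each event
  inserts at most one task and extracts a lightest one. Hence a task that is started from the queue
  is preceded only by tasks of at most its weight, and all machines are busy until then. An
  execution that is not started from the queue directly follows its test. So the completion time
  of \<open>j\<close> is at most its own running time plus \<open>1/m\<close> times the durations of tasks of other jobs that
  delay it, and a case analysis shows that two jobs delay each other by at most the bound attached
  in the numerator of \<open>R\<close> to either of them. In expectation, with \<open>o\<^sub>j\<close> for \<open>p\<^sub>j\<^sup>*\<close>, the cost is at most
  \<open>r \<cdot> (\<Sum>j. o\<^sub>j) + R / (2m) \<cdot> (\<Sum>j\<noteq>k. min o\<^sub>j o\<^sub>k)\<close>.

  For the optimum, the completion time of \<open>j\<close> is at least its mean busy time plus half its running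
  time. Bounding a weighted sum of mean busy times machine by machine, and combining the machines
  by the Cauchy-Schwarz inequality for the positive semidefinite kernel \<open>min\<close>, gives
  \<open>OPT \<ge> (\<Sum>j\<noteq>k. min o\<^sub>j o\<^sub>k) / (2m) + (1/2 + 1/(2m)) \<cdot> (\<Sum>j. o\<^sub>j)\<close>. Together with
  \<open>OPT \<ge> (\<Sum>j. o\<^sub>j)\<close> and \<open>r \<le> R \<le> 2r\<close> this yields the ratio.
\<close>

section \<open>Runs of the algorithm\<close>

definition job_tasks :: "nat set \<Rightarrow> nat \<Rightarrow> task set" where
  "job_tasks T j = (if j \<in> T then {Test j, Exec j} else {Untested j})"

definition all_tasks :: "jobs \<Rightarrow> nat set \<Rightarrow> task set" where
  "all_tasks I T = Test ` T \<union> Exec ` T \<union> Untested ` ({..<length I} - T)"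

lemma finite_all_tasks: "T \<subseteq> {..<length I} \<Longrightarrow> finite (all_tasks I T)"
  by (auto simp: all_tasks_def intro: finite_subset)

lemma duration_nonneg:
  "valid_instance I \<Longrightarrow> T \<subseteq> {..<length I} \<Longrightarrow> x \<in> all_tasks I T \<Longrightarrow> 0 \<le> duration I x"
  by (force simp: all_tasks_def valid_instance_def valid_job_def less_imp_le)

text \<open>A test counts as running until the idle event of its machine is handled, because only
  that step inserts the execution task.\<close>

definition test_running :: "state \<Rightarrow> nat \<Rightarrow> bool" where
  "test_running s j \<longleftrightarrow> (\<exists>i f. machines s i = Some (Some (Test j), f))"

text \<open>The conjunct on \<open>Exec j\<close> prevents a second insertion of an execution task.
  By the last conjunct, a task taken from the old queue witnesses that no machine has stopped
  yet.\<close>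

definition consistent :: "nat \<Rightarrow> jobs \<Rightarrow> nat set \<Rightarrow> state \<Rightarrow> bool" where
  "consistent m I T s \<longleftrightarrow>
     dom (started s) \<inter> queue s = {} \<and>
     dom (started s) \<union> queue s \<subseteq> all_tasks I T \<and>
     Test ` T \<union> Untested ` ({..<length I} - T) \<subseteq> dom (started s) \<union> queue s \<and>
     (\<forall>j\<in>T. Exec j \<in> dom (started s) \<union> queue s \<longleftrightarrow> Test j \<notin> queue s \<and> \<not> test_running s j) \<and>
     (\<forall>i x f. machines s i = Some (x, f) \<longrightarrow> i < m \<and> 0 \<le> f) \<and>
     (\<forall>i x f. machines s i = Some (Some x, f) \<longrightarrow>
        x \<in> dom (started s) \<and> machine_of (started s) x = i \<and> end_of I (started s) x = f) \<and>
     ((\<exists>i<m. machines s i = None) \<longrightarrow> queue s = {})"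

lemma consistentD:
  assumes "consistent m I T s"
  shows "dom (started s) \<inter> queue s = {}"
    and "dom (started s) \<union> queue s \<subseteq> all_tasks I T"
    and "Test ` T \<union> Untested ` ({..<length I} - T) \<subseteq> dom (started s) \<union> queue s"
    and "\<And>j. j \<in> T \<Longrightarrow>
      Exec j \<in> dom (started s) \<union> queue s \<longleftrightarrow> Test j \<notin> queue s \<and> \<not> test_running s j"
    and "\<And>i x f. machines s i = Some (x, f) \<Longrightarrow> i < m \<and> 0 \<le> f"
    and "\<And>i x f. machines s i = Some (Some x, f) \<Longrightarrow>
      x \<in> dom (started s) \<and> machine_of (started s) x = i \<and> end_of I (started s) x = f"
    and "\<And>i. i < m \<Longrightarrow> machines s i = None \<Longrightarrow> queue s = {}"
  using assms unfolding consistent_def by blast+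

lemma released_iff: "y \<in> released x \<longleftrightarrow> (\<exists>j. x = Some (Test j) \<and> y = Exec j)"
  by (cases x rule: released.cases) auto

lemma consistent_not_running:
  assumes "consistent m I T s" and "test_running s j"
  shows "j \<in> T" "Exec j \<notin> dom (started s)" "Exec j \<notin> queue s" "Test j \<in> dom (started s)"
proof -
  obtain i f where i: "machines s i = Some (Some (Test j), f)"
    using assms(2) by (auto simp: test_running_def)
  show 1: "Test j \<in> dom (started s)" using consistentD(6)[OF assms(1) i] by blast
  show 2: "j \<in> T" using 1 consistentD(2)[OF assms(1)] by (auto simp: all_tasks_def)
  show "Exec j \<notin> dom (started s)" "Exec j \<notin> queue s"
    using consistentD(4)[OF assms(1) 2] assms(2) by auto
qed

lemma consistent_Exec:
  assumes c: "consistent m I T s" and E: "Exec j \<in> dom (started s) \<union> queue s"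
  shows "Test j \<in> dom (started s)"
proof -
  have "j \<in> T" using E consistentD(2)[OF c] by (auto simp: all_tasks_def)
  then show ?thesis using consistentD(3,4)[OF c] E by blast
qed

lemma consistent_initial:
  assumes "T \<subseteq> {..<length I}"
  shows "consistent m I T (initial_state m I T)"
  using assms by (auto simp: consistent_def initial_state_def all_tasks_def test_running_def
      split: if_splits)

lemma consistent_chosen:
  assumes c: "consistent m I T s" and n: "next_idle s i x f"
    and y: "y \<in> queue s \<union> released x"
  shows "y \<notin> dom (started s)" "y \<in> all_tasks I T" "i < m" "0 \<le> f"
proof -
  have mi: "machines s i = Some (x, f)" using n by (simp add: next_idle_def)
  show "i < m" "0 \<le> f" using consistentD(5)[OF c mi] by auto
  have r: "Exec j \<notin> dom (started s) \<and> j \<in> T" if "x = Some (Test j)" for j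
  proof -
    have "test_running s j" using mi that by (auto simp: test_running_def)
    then show ?thesis using consistent_not_running[OF c] by blast
  qed
  show "y \<notin> dom (started s)"
    using y r consistentD(1)[OF c] by (auto simp: released_iff)
  show "y \<in> all_tasks I T"
    using y r consistentD(2)[OF c] by (auto simp: released_iff all_tasks_def)
qed

lemma consistent_step:
  assumes "step \<beta> I s s'" and c: "consistent m I T s" and d: "\<And>x. x \<in> all_tasks I T \<Longrightarrow> 0 \<le> duration I x"
  shows "consistent m I T s'"
  using assms(1)
proof cases
  case (start i x f Q y)
  have mi: "machines s i = Some (x, f)" using start by (simp add: next_idle_def)
  note y = consistent_chosen[OF c start(2)] start(3,4)
  define \<sigma> where "\<sigma> = (started s)(y \<mapsto> (i, f))"
  have ynd: "y \<notin> dom (started s)" and yall: "y \<in> all_tasks I T" using y by auto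
  have Qall: "Q \<subseteq> all_tasks I T" "Q \<inter> dom (started s) = {}"
    using consistent_chosen(1,2)[OF c start(2)] start(3) by blast+
  have m_old: "z \<in> dom (started s) \<and> z \<noteq> y \<and> machine_of \<sigma> z = i' \<and> end_of I \<sigma> z = f' \<and> i' \<noteq> i"
    if "machines s i' = Some (Some z, f')" "i' \<noteq> i" for i' z f'
    using consistentD(6)[OF c that(1)] ynd that(2)
    by (auto simp: \<sigma>_def machine_of_def end_of_def start_of_def)
  have tr: "test_running s' j \<longleftrightarrow> y = Test j \<or> (test_running s j \<and> x \<noteq> Some (Test j))" for j
  proof -
    \<comment> \<open>A test sits on one machine only, because \<open>machine_of\<close> is a
      function; overwriting the entry of machine \<open>i\<close> therefore ends that test
      everywhere.\<close>
    have u: "i' = i" if "machines s i' = Some (Some (Test j), f')" "x = Some (Test j)" for i' f'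
      using consistentD(6)[OF c that(1)] consistentD(6)[OF c, of i "Test j" f] mi that(2) by auto
    have "test_running s' j \<longleftrightarrow>
        y = Test j \<or> (\<exists>i' f'. i' \<noteq> i \<and> machines s i' = Some (Some (Test j), f'))"
      unfolding start(1) by (auto simp: test_running_def)
    also have "(\<exists>i' f'. i' \<noteq> i \<and> machines s i' = Some (Some (Test j), f')) \<longleftrightarrow>
        test_running s j \<and> x \<noteq> Some (Test j)"
      using mi u unfolding test_running_def by (metis option.inject prod.inject)
    finally show ?thesis .
  qed
  show ?thesis
    unfolding consistent_def
  proof (intro conjI allI impI ballI)
    show "dom (started s') \<inter> queue s' = {}" using Qall start(1) by auto
    show "dom (started s') \<union> queue s' \<subseteq> all_tasks I T"
      using Qall yall consistentD(2)[OF c] start(1) by auto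
    show "Test ` T \<union> Untested ` ({..<length I} - T) \<subseteq> dom (started s') \<union> queue s'"
      using consistentD(3)[OF c] start(1,3) by auto
    show "Exec j \<in> dom (started s') \<union> queue s' \<longleftrightarrow> Test j \<notin> queue s' \<and> \<not> test_running s' j"
      if j: "j \<in> T" for j
    proof -
      have du: "dom (started s') \<union> queue s' = dom (started s) \<union> queue s \<union> released x"
        using start by auto
      have rx: "Test j \<notin> released x" by (auto simp: released_iff)
      have tq: "Test j \<notin> queue s" if "x = Some (Test j)"
        using consistentD(6)[OF c, of i "Test j" f] mi that consistentD(1)[OF c] by auto
      have tx: "test_running s j" if "x = Some (Test j)"
        using mi that by (auto simp: test_running_def)
      show ?thesis unfolding du tr
        using consistentD(4)[OF c j] rx tq tx start(1,3,4) by (auto simp: released_iff)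
    qed
    show "i' < m" "0 \<le> f'" if "machines s' i' = Some (x', f')" for i' x' f'
      using that consistentD(5)[OF c mi] consistentD(5)[OF c] d[OF yall]
      by (auto simp: start(1) split: if_splits)
    show "x' \<in> dom (started s')" "machine_of (started s') x' = i'" "end_of I (started s') x' = f'"
      if "machines s' i' = Some (Some x', f')" for i' x' f'
      using that m_old[of i' x' f'] unfolding start(1) \<sigma>_def
      by (auto simp: machine_of_def end_of_def start_of_def split: if_splits)
    show "queue s' = {}" if "\<exists>i<m. machines s' i = None"
    proof -
      obtain i' where i': "i' < m" "machines s' i' = None"
        using \<open>\<exists>i<m. machines s' i = None\<close> by blast
      \<comment> \<open>The machine handled in this step is running afterwards, so \<open>i'\<close>
        had stopped before. Hence the old queue was empty and \<open>Q\<close> holds only the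
        released task, which is \<open>y\<close>.\<close>
      then have "machines s i' = None" by (auto simp: start(1) split: if_splits)
      then have "queue s = {}" using consistentD(7)[OF c] i'(1) by blast
      then show ?thesis using start(1,3,4) by (auto simp: released_iff)
    qed
  qed
next
  case (stop i x f)
  have mi: "machines s i = Some (x, f)" using stop by (simp add: next_idle_def)
  \<comment> \<open>A machine stops only if its last task releases nothing, so that task was not a
    test.\<close>
  have "i' \<noteq> i" if "machines s i' = Some (Some (Test j), f')" for i' j f'
    using mi that stop(3) by auto
  then have "test_running s' j \<longleftrightarrow> test_running s j" for j
    unfolding test_running_def stop(1) by (auto split: if_splits)
  then show ?thesis
    using c stop(1,3) unfolding consistent_def by (auto split: if_splits)
qed

section \<open>Tasks in the order of their starts\<close>

definition preds :: "schedule \<Rightarrow> (task \<Rightarrow> nat) \<Rightarrow> task \<Rightarrow> task set" where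
  "preds \<sigma> ord y = {z \<in> dom \<sigma>. ord z < ord y}"

text \<open>All \<open>m\<close> machines are busy until \<open>y\<close> starts, so
  \<open>m\<close> times its start is at most the work started before it. Later arguments use the
  busy period only in this averaged form.\<close>

definition started_from_queue ::
  "nat \<Rightarrow> real \<Rightarrow> jobs \<Rightarrow> schedule \<Rightarrow> (task \<Rightarrow> nat) \<Rightarrow> task \<Rightarrow> bool" where
  "started_from_queue m \<beta> I \<sigma> ord y \<longleftrightarrow>
     real m * start_of \<sigma> y \<le> (\<Sum>z\<in>preds \<sigma> ord y. duration I z) \<and>
     (\<forall>z\<in>preds \<sigma> ord y. weight \<beta> I z \<le> weight \<beta> I y)"

text \<open>\<open>ord\<close> numbers the tasks in the order in which they are started. Starting times alone do not
  determine this order, since several tasks may start at the same time.\<close>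

definition greedy_order :: "nat \<Rightarrow> real \<Rightarrow> jobs \<Rightarrow> schedule \<Rightarrow> (task \<Rightarrow> nat) \<Rightarrow> bool" where
  "greedy_order m \<beta> I \<sigma> ord \<longleftrightarrow>
     (\<forall>z\<in>dom \<sigma>. ord z < card (dom \<sigma>)) \<and>
     (\<forall>j. Exec j \<in> dom \<sigma> \<longrightarrow> ord (Test j) < ord (Exec j)) \<and>
     (\<forall>y\<in>dom \<sigma>. 0 \<le> start_of \<sigma> y \<and>
        (started_from_queue m \<beta> I \<sigma> ord y \<or>
         (\<exists>j. y = Exec j \<and> start_of \<sigma> y = end_of I \<sigma> (Test j))))"

text \<open>The second conjunct is what makes the analysis work: although an inserted execution task may
  have a small weight, it is inserted together with the extraction of a task of smallest weight.\<close>

definition busy_sorted :: "nat \<Rightarrow> real \<Rightarrow> jobs \<Rightarrow> state \<Rightarrow> bool" where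
  "busy_sorted m \<beta> I s \<longleftrightarrow>
     ((\<forall>i<m. machines s i \<noteq> None) \<longrightarrow>
        (\<Sum>i<m. snd (the (machines s i))) = (\<Sum>z\<in>dom (started s). duration I z)) \<and>
     (\<forall>z\<in>dom (started s). \<forall>q\<in>queue s. weight \<beta> I z \<le> weight \<beta> I q)"

lemma busy_sorted_initial: "busy_sorted m \<beta> I (initial_state m I T)"
  by (simp add: busy_sorted_def initial_state_def)

text \<open>A stopped machine never resumes. So while no machine has stopped, none has been idle,
  and each start adds the duration of the new task to both sums.\<close>

lemma busy_sorted_step:
  assumes st: "step \<beta> I s s'" and c: "consistent m I T s" and b: "busy_sorted m \<beta> I s"
    and fin: "finite (dom (started s))"
  shows "busy_sorted m \<beta> I s'"
  using st
proof cases
  case (start i x f Q y)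
  have mi: "machines s i = Some (x, f)" using start by (simp add: next_idle_def)
  have "y \<in> queue s \<union> released x" using start(3,4) by simp
  note y = consistent_chosen[OF c start(2) this]
  have sum: "(\<Sum>i<m. snd (the (machines s' i))) = (\<Sum>z\<in>dom (started s'). duration I z)"
    if "\<forall>i<m. machines s' i \<noteq> None"
  proof -
    have "machines s i' \<noteq> None" if "i' < m" for i'
      using \<open>\<forall>i<m. machines s' i \<noteq> None\<close> that mi by (auto simp: start(1) split: if_splits)
    then have old: "(\<Sum>i<m. snd (the (machines s i))) = (\<Sum>z\<in>dom (started s). duration I z)"
      using b by (simp add: busy_sorted_def)
    have "(\<Sum>i'\<in>{..<m} - {i}. snd (the (machines s' i'))) = (\<Sum>i'\<in>{..<m} - {i}. snd (the (machines s i')))"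
      by (intro sum.cong) (auto simp: start(1))
    then have "(\<Sum>i<m. snd (the (machines s' i))) = (\<Sum>i<m. snd (the (machines s i))) + duration I y"
      using y(3) mi by (simp add: sum.remove[of "{..<m}" i] start(1))
    also have "\<dots> = (\<Sum>z\<in>dom (started s'). duration I z)"
      using old fin y(1) by (simp add: start(1))
    finally show ?thesis .
  qed
  have sorted: "weight \<beta> I z \<le> weight \<beta> I q" if "z \<in> dom (started s')" "q \<in> queue s'" for z q
  proof (cases "z = y")
    case True then show ?thesis using that start(1,5) by auto
  next
    case False
    then have z: "z \<in> dom (started s)" using that by (simp add: start(1))
    have old: "weight \<beta> I z \<le> weight \<beta> I q'" if "q' \<in> queue s" for q'
      using b z that by (simp add: busy_sorted_def)
    have q: "q \<in> Q" "q \<noteq> y" using that by (auto simp: start(1))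
    show ?thesis
    proof (cases "q \<in> queue s")
      case False
      \<comment> \<open>Here \<open>q\<close> is the one released task, so \<open>y\<close> comes
        from the old queue: \<open>z\<close> weighs at most as much as \<open>y\<close> by the
        invariant, and \<open>y\<close> at most as much as \<open>q\<close> by its choice.\<close>
      then have "y \<in> queue s" using q start(3,4) by (auto simp: released_iff)
      then show ?thesis using old start(5) q(1) by force
    qed (use old in blast)
  qed
  show ?thesis unfolding busy_sorted_def using sum sorted by blast
next
  case (stop i x f)
  have "i < m" using consistentD(5)[OF c] stop(2) by (auto simp: next_idle_def)
  then show ?thesis using stop(1,3) unfolding busy_sorted_def by auto
qed

text \<open>The new task is numbered by the count of tasks started so far. All of these become its
  predecessors, and the predecessor sets of older tasks do not change.\<close>

lemma greedy_order_step:
  assumes st: "step \<beta> I s s'" and c: "consistent m I T s" and b: "busy_sorted m \<beta> I s"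
    and fin: "finite (dom (started s))" and g: "greedy_order m \<beta> I (started s) ord"
  shows "\<exists>ord. greedy_order m \<beta> I (started s') ord"
  using st
proof cases
  case (start i x f Q y)
  have mi: "machines s i = Some (x, f)" using start by (simp add: next_idle_def)
  have yQ: "y \<in> queue s \<union> released x" using start(3,4) by simp
  note y = consistent_chosen[OF c start(2) yQ]
  define \<sigma> where "\<sigma> = started s"
  define \<sigma>' where "\<sigma>' = \<sigma>(y \<mapsto> (i, f))"
  define ord' where "ord' = ord(y := card (dom \<sigma>))"
  have s': "started s' = \<sigma>'" by (simp add: start(1) \<sigma>'_def \<sigma>_def)
  have ynd: "y \<notin> dom \<sigma>" and fin\<sigma>: "finite (dom \<sigma>)" using y(1) fin by (auto simp: \<sigma>_def)
  have dom': "dom \<sigma>' = insert y (dom \<sigma>)" by (simp add: \<sigma>'_def)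
  have g\<sigma>: "ord z < card (dom \<sigma>)" "0 \<le> start_of \<sigma> z"
    "started_from_queue m \<beta> I \<sigma> ord z \<or> (\<exists>j. z = Exec j \<and> start_of \<sigma> z = end_of I \<sigma> (Test j))"
    if "z \<in> dom \<sigma>" for z
    using g that by (auto simp: greedy_order_def \<sigma>_def)
  have ord': "ord' y = card (dom \<sigma>)" "\<And>z. z \<in> dom \<sigma> \<Longrightarrow> ord' z = ord z"
    using ynd by (auto simp: ord'_def)
  have start': "start_of \<sigma>' y = f" "\<And>z. z \<in> dom \<sigma> \<Longrightarrow> start_of \<sigma>' z = start_of \<sigma> z"
    using ynd by (auto simp: \<sigma>'_def start_of_def)
  have preds_y: "preds \<sigma>' ord' y = dom \<sigma>"
  proof -
    have "ord' z < ord' y" if "z \<in> dom \<sigma>" for z using that ord' g\<sigma>(1) by simp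
    then show ?thesis unfolding preds_def dom' by blast
  qed
  have preds': "preds \<sigma>' ord' z = preds \<sigma> ord z" if z: "z \<in> dom \<sigma>" for z
  proof -
    have "x \<in> preds \<sigma>' ord' z \<longleftrightarrow> x \<in> preds \<sigma> ord z" for x
      using g\<sigma>(1)[OF z] ynd ord'(2)[OF z] ord'(1) ord'(2)[of x]
      by (cases "x \<in> dom \<sigma>"; cases "x = y") (simp_all add: preds_def dom' del: domIff)
    then show ?thesis by blast
  qed
  have test_started: "Test j \<in> dom \<sigma> \<and> Test j \<noteq> y" if "Exec j \<in> dom \<sigma>'" for j
  proof -
    have "Exec j \<in> dom \<sigma> \<union> queue s \<or> x = Some (Test j)"
      using that yQ by (auto simp: dom' released_iff)
    then have "Test j \<in> dom \<sigma>"
      using consistent_Exec[OF c] consistentD(6)[OF c, of i "Test j" f] mi by (auto simp: \<sigma>_def)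
    then show ?thesis using ynd by auto
  qed
  have "greedy_order m \<beta> I \<sigma>' ord'"
    unfolding greedy_order_def
  proof (intro conjI allI impI ballI)
    show "ord' z < card (dom \<sigma>')" if "z \<in> dom \<sigma>'" for z
    proof -
      have "card (dom \<sigma>') = Suc (card (dom \<sigma>))" unfolding dom' using ynd fin\<sigma> by (rule card_insert_disjoint[rotated])
      moreover have "z = y \<or> z \<in> dom \<sigma>" using that by (simp add: dom')
      ultimately show ?thesis using g\<sigma>(1)[of z] ord' by (metis less_Suc_eq)
    qed
    show "ord' (Test j) < ord' (Exec j)" if "Exec j \<in> dom \<sigma>'" for j
    proof (cases "Exec j = y")
      case True
      then show ?thesis using test_started[OF that] ord' g\<sigma>(1) by auto
    next
      case False
      then have "Exec j \<in> dom \<sigma>" using that by (simp add: dom')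
      then show ?thesis using test_started[OF that] ord'(2) g by (simp add: greedy_order_def \<sigma>_def)
    qed
    show "0 \<le> start_of \<sigma>' z" if "z \<in> dom \<sigma>'" for z
    proof -
      have "z = y \<or> z \<in> dom \<sigma>" using that by (simp add: dom')
      then show ?thesis using start' g\<sigma>(2)[of z] y(4) by metis
    qed
    show "started_from_queue m \<beta> I \<sigma>' ord' z \<or>
        (\<exists>j. z = Exec j \<and> start_of \<sigma>' z = end_of I \<sigma>' (Test j))" if z: "z \<in> dom \<sigma>'" for z
    proof (cases "z = y")
      case False
      then have z: "z \<in> dom \<sigma>" using z by (simp add: dom')
      have "started_from_queue m \<beta> I \<sigma>' ord' z" if "started_from_queue m \<beta> I \<sigma> ord z"
        using that start'(2)[OF z] preds'[OF z] by (simp add: started_from_queue_def)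
      moreover have "start_of \<sigma>' z = end_of I \<sigma>' (Test j)"
        if "z = Exec j" "start_of \<sigma> z = end_of I \<sigma> (Test j)" for j
        using that start'(2)[OF z] start'(2)[of "Test j"] test_started[of j] z
        by (simp add: dom' end_of_def)
      ultimately show ?thesis using g\<sigma>(3)[OF z] by blast
    next
      case [simp]: True
      show ?thesis
      proof (cases "y \<in> queue s")
        case True
        then have all: "machines s i' \<noteq> None" if "i' < m" for i'
          using consistentD(7)[OF c that] by blast
        \<comment> \<open>The machine handled is one that becomes idle first, so \<open>f\<close> is
          at most each of the \<open>m\<close> finishing times, whose sum is the work started so
          far.\<close>
        have "real m * f = (\<Sum>i<m. f)" by simp
        also have "\<dots> \<le> (\<Sum>i<m. snd (the (machines s i)))"
        proof (rule sum_mono)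
          fix i' assume "i' \<in> {..<m}"
          then obtain x' f' where "machines s i' = Some (x', f')" using all by fastforce
          then show "f \<le> snd (the (machines s i'))" using start(2) by (auto simp: next_idle_def)
        qed
        also have "\<dots> = (\<Sum>z\<in>dom \<sigma>. duration I z)" using b all by (simp add: busy_sorted_def \<sigma>_def)
        finally have "started_from_queue m \<beta> I \<sigma>' ord' y"
          using b True by (simp add: started_from_queue_def preds_y start' busy_sorted_def \<sigma>_def)
        then show ?thesis by simp
      next
        case False
        then obtain j where j: "x = Some (Test j)" "y = Exec j" using yQ by (auto simp: released_iff)
        have "Test j \<in> dom \<sigma>" "end_of I \<sigma> (Test j) = f"
          using consistentD(6)[OF c, of i "Test j" f] mi j(1) by (auto simp: \<sigma>_def)
        then have "start_of \<sigma>' y = end_of I \<sigma>' (Test j)" using start' by (simp add: end_of_def)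
        then show ?thesis using j(2) by simp
      qed
    qed
  qed
  then show ?thesis unfolding s' by blast
next
  case (stop i x f)
  then show ?thesis using g by auto
qed

lemma RPCPM_schedule_greedy:
  assumes "1 \<le> m" and V: "valid_instance I" and T: "T \<subseteq> {..<length I}"
    and \<sigma>: "\<sigma> \<in> RPCPM_schedules m \<beta> I T"
  obtains ord where "dom \<sigma> = all_tasks I T" "greedy_order m \<beta> I \<sigma> ord"
proof -
  obtain s where s: "(step \<beta> I)\<^sup>*\<^sup>* (initial_state m I T) s" and idle: "\<And>i. machines s i = None"
    and [simp]: "\<sigma> = started s"
    using \<sigma> by (auto simp: RPCPM_schedules_def)
  have "consistent m I T s \<and> busy_sorted m \<beta> I s \<and> (\<exists>ord. greedy_order m \<beta> I (started s) ord)"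
    using s
  proof induction
    case base
    show ?case using consistent_initial[OF T] busy_sorted_initial
      by (auto simp: greedy_order_def initial_state_def)
  next
    case (step s s')
    have "finite (dom (started s))"
      using step.IH consistentD(2) finite_all_tasks[OF T] by (meson finite_subset le_sup_iff)
    then show ?case
      using step consistent_step duration_nonneg[OF V T] busy_sorted_step greedy_order_step by metis
  qed
  then obtain ord where c: "consistent m I T s" and o: "greedy_order m \<beta> I (started s) ord" by blast
  \<comment> \<open>As \<open>m\<close> is positive, machine 0 exists and has stopped, so the queue
    is empty; with no test running, every execution task has been inserted and started.\<close>
  have q: "queue s = {}" using consistentD(7)[OF c, of 0] idle assms(1) by simp
  have "\<not> test_running s j" for j by (simp add: test_running_def idle)
  then have "dom \<sigma> = all_tasks I T"
    using consistentD(2-4)[OF c] q unfolding all_tasks_def by simp blast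
  then show ?thesis using that o by simp
qed

section \<open>Delays between pairs of jobs\<close>

definition run_time :: "jobs \<Rightarrow> nat set \<Rightarrow> nat \<Rightarrow> real" where
  "run_time I T j = (if j \<in> T then test_time (I ! j) + proc_time (I ! j) else upper_limit (I ! j))"

text \<open>The two branches, weighted by the probabilities of testing and not testing
  \<open>j\<close>, add up to the numerator of \<open>R_ratio\<close>.\<close>

definition pair_bound :: "real \<Rightarrow> jobs \<Rightarrow> nat set \<Rightarrow> nat \<Rightarrow> real" where
  "pair_bound \<beta> I T j = (let t = test_time (I ! j); u = upper_limit (I ! j); p = proc_time (I ! j) in
     if j \<in> T then Max {2 * t + p, \<beta> * t, (1 + 1 / \<beta>) * (t + p)} else (1 + 1 / \<beta>) * u)"

locale greedy_schedule =
  fixes m :: nat and \<beta> :: real and I :: jobs and T :: "nat set"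
    and \<sigma> :: schedule and ord :: "task \<Rightarrow> nat"
  assumes m: "1 \<le> m" and \<beta>: "0 < \<beta>" and valid: "valid_instance I" and T: "T \<subseteq> {..<length I}"
    and dom: "dom \<sigma> = all_tasks I T" and greedy: "greedy_order m \<beta> I \<sigma> ord"
begin

abbreviation "t j \<equiv> test_time (I ! j)"
abbreviation "u j \<equiv> upper_limit (I ! j)"
abbreviation "p j \<equiv> proc_time (I ! j)"

lemma job_nonneg: "j < length I \<Longrightarrow> 0 < t j \<and> 0 < u j \<and> 0 \<le> p j"
  using valid by (simp add: valid_instance_def valid_job_def)

lemma Test_before_Exec: "j \<in> T \<Longrightarrow> ord (Test j) < ord (Exec j)"
  using greedy dom by (simp add: greedy_order_def all_tasks_def)

lemma start_nonneg: "y \<in> dom \<sigma> \<Longrightarrow> 0 \<le> start_of \<sigma> y"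
  using greedy by (simp add: greedy_order_def)

lemma from_queue_or_after_test:
  "y \<in> dom \<sigma> \<Longrightarrow> started_from_queue m \<beta> I \<sigma> ord y \<or>
    (\<exists>j. y = Exec j \<and> start_of \<sigma> y = start_of \<sigma> (Test j) + t j)"
  using greedy unfolding greedy_order_def end_of_def duration.simps by blast

lemma Test_from_queue: "j \<in> T \<Longrightarrow> started_from_queue m \<beta> I \<sigma> ord (Test j)"
  using from_queue_or_after_test[of "Test j"] unfolding dom all_tasks_def by simp

lemma Untested_from_queue:
  "j < length I \<Longrightarrow> j \<notin> T \<Longrightarrow> started_from_queue m \<beta> I \<sigma> ord (Untested j)"
  using from_queue_or_after_test[of "Untested j"] unfolding dom all_tasks_def by simp

lemma Exec_not_from_queue:
  "j \<in> T \<Longrightarrow> \<not> started_from_queue m \<beta> I \<sigma> ord (Exec j) \<Longrightarrow>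
    start_of \<sigma> (Exec j) = start_of \<sigma> (Test j) + t j"
  using from_queue_or_after_test[of "Exec j"] unfolding dom all_tasks_def by simp

text \<open>If the execution of \<open>j\<close> directly follows its test, then \<open>j\<close> is delayed only by what is
  started before the test.\<close>

definition delaying :: "nat \<Rightarrow> task set" where
  "delaying j =
     (if j \<notin> T then preds \<sigma> ord (Untested j)
      else if started_from_queue m \<beta> I \<sigma> ord (Exec j) then preds \<sigma> ord (Exec j)
      else preds \<sigma> ord (Test j))"

definition delay :: "nat \<Rightarrow> nat \<Rightarrow> real" where
  "delay k j = (\<Sum>z\<in>job_tasks T k \<inter> delaying j. duration I z)"

lemma delaying_untested:
  assumes "j < length I" "j \<notin> T" "z \<in> delaying j"
  shows "ord z < ord (Untested j)" "weight \<beta> I z \<le> u j"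
  using assms Untested_from_queue[OF assms(1,2)]
  by (auto simp: delaying_def preds_def started_from_queue_def)

text \<open>If the execution starts from the queue, its predecessors weigh at most
  \<open>t j + p j\<close>. Otherwise only predecessors of the test count, and these weigh at most
  \<open>\<beta> * t j\<close>; the order kept in that case later rules out some mutual
  delays.\<close>

lemma delaying_tested:
  assumes "j \<in> T" "z \<in> delaying j"
  shows "ord z < ord (Exec j)"
    and "ord z < ord (Test j) \<and> weight \<beta> I z \<le> \<beta> * t j \<or> weight \<beta> I z \<le> t j + p j"
  using assms Test_from_queue[OF assms(1)] Test_before_Exec[OF assms(1)]
  by (auto simp: delaying_def preds_def started_from_queue_def split: if_splits)

lemma delay_untested: "k \<notin> T \<Longrightarrow> delay k j = (if Untested k \<in> delaying j then u k else 0)"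
  by (simp add: delay_def job_tasks_def)

lemma delay_tested: "k \<in> T \<Longrightarrow> delay k j =
    (if Test k \<in> delaying j then t k else 0) + (if Exec k \<in> delaying j then p k else 0)"
  by (simp add: delay_def job_tasks_def)

text \<open>The final tasks of the two jobs cannot delay each other, since each delay forces an
  order on them. Whatever else of \<open>k\<close> delays \<open>j\<close> is bounded through its
  weight.\<close>

lemma delay_pair_le:
  assumes jk: "j < length I" "k < length I" "j \<noteq> k"
  shows "delay j k + delay k j \<le> pair_bound \<beta> I T j"
proof -
  note pos = job_nonneg[OF jk(1)] job_nonneg[OF jk(2)]
  have inv: "x / \<beta> + x = (1 + 1 / \<beta>) * x" for x using \<beta> by (simp add: field_simps)
  have le_div: "t k \<le> x / \<beta>" if "\<beta> * t k \<le> x" for x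
    using that \<beta> by (simp add: field_simps)
  have div0: "0 \<le> x / \<beta>" if "0 \<le> x" for x using that \<beta> by simp
  show ?thesis
  proof (cases "j \<in> T")
    case False
    then have g: "pair_bound \<beta> I T j = u j / \<beta> + u j" by (simp add: pair_bound_def inv)
    note D = delaying_untested[OF jk(1) False]
    show ?thesis
    proof (cases "k \<in> T")
      case True
      \<comment> \<open>If the execution of \<open>k\<close> delays \<open>j\<close>, then
        \<open>t k + p k \<le> u j\<close> and \<open>j\<close> does not delay \<open>k\<close>.
        Otherwise at most the test of \<open>k\<close> delays \<open>j\<close>, costing at most
        \<open>u j / \<beta>\<close>, and \<open>j\<close> delays \<open>k\<close> by at most
        \<open>u j\<close>.\<close>
      show ?thesis
        using D[of "Test k"] D[of "Exec k"] delaying_tested[OF True, of "Untested j"]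
          le_div[of "u j"] div0[of "u j"] pos
        unfolding g delay_tested[OF True] delay_untested[OF False] by auto
    next
      case k: False
      show ?thesis
        using D[of "Untested k"] delaying_untested[OF jk(2) k, of "Untested j"] div0[of "u j"] pos
        unfolding g delay_untested[OF k] delay_untested[OF False] by auto
    qed
  next
    case True
    then have g: "2 * t j + p j \<le> pair_bound \<beta> I T j" "\<beta> * t j \<le> pair_bound \<beta> I T j"
      "(t j + p j) / \<beta> + (t j + p j) \<le> pair_bound \<beta> I T j"
      by (simp_all add: pair_bound_def inv Let_def)
    note D = delaying_tested[OF True]
    show ?thesis
    proof (cases "k \<in> T")
      case k: True
      note D' = delaying_tested[OF k]
      show ?thesis
      proof (cases "Exec k \<in> delaying j")
        case E: True
        \<comment> \<open>The execution of \<open>j\<close> does not delay \<open>k\<close>. If the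
          test of \<open>j\<close> does, it precedes the execution of \<open>k\<close>, which leaves
          \<open>t k + p k \<le> t j + p j\<close> and a total of at most
          \<open>2 * t j + p j\<close>. If not, the total is at most \<open>\<beta> * t j\<close> or
          \<open>t j + p j\<close>.\<close>
        then show ?thesis
          using D[OF E] D'(1)[of "Exec j"] D'(1)[of "Test j"] g pos
          unfolding delay_tested[OF True] delay_tested[OF k] by auto
      next
        case E: False
        show ?thesis
        proof (cases "Test k \<in> delaying j")
          case True
          \<comment> \<open>After adding at most \<open>t j + p j\<close> for the delay caused by
            \<open>j\<close>, the alternatives give the first and the third term of the
            maximum.\<close>
          have "t k \<le> t j \<or> t k \<le> (t j + p j) / \<beta>"
            using D(2)[OF True] le_div \<beta> by auto
          then show ?thesis using E g pos unfolding delay_tested[OF \<open>j \<in> T\<close>] delay_tested[OF k] by auto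
        next
          case False
          then show ?thesis using E g pos unfolding delay_tested[OF \<open>j \<in> T\<close>] delay_tested[OF k] by auto
        qed
      qed
    next
      case k: False
      \<comment> \<open>If \<open>k\<close> starts before the test of \<open>j\<close> and
        \<open>u k \<le> \<beta> * t j\<close>, nothing of \<open>j\<close> delays \<open>k\<close>.
        If \<open>k\<close> delays \<open>j\<close> with \<open>u k \<le> t j + p j\<close>, at most
        the test of \<open>j\<close> delays \<open>k\<close>. If \<open>k\<close> does not delay
        \<open>j\<close>, the total is at most \<open>t j + p j\<close>.\<close>
      show ?thesis
        using D[of "Untested k"] delaying_untested[OF jk(2) k, of "Exec j"]
          delaying_untested[OF jk(2) k, of "Test j"] g pos
        unfolding delay_tested[OF True] delay_untested[OF k] by auto
    qed
  qed
qed

lemma sum_delaying: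
  assumes j: "j < length I"
  shows "(\<Sum>z\<in>delaying j. duration I z) = delay j j + (\<Sum>k\<in>{..<length I} - {j}. delay k j)"
proof -
  have "delaying j \<subseteq> (\<Union>k<length I. job_tasks T k)"
    using T dom by (auto simp: delaying_def preds_def all_tasks_def job_tasks_def split: if_splits)
  then have "delaying j = (\<Union>k<length I. job_tasks T k \<inter> delaying j)" by blast
  then have "(\<Sum>z\<in>delaying j. duration I z) = (\<Sum>z\<in>(\<Union>k<length I. job_tasks T k \<inter> delaying j). duration I z)"
    by simp
  also have "\<dots> = (\<Sum>k<length I. delay k j)"
    unfolding delay_def by (rule sum.UNION_disjoint) (auto simp: job_tasks_def split: if_splits)
  also have "\<dots> = delay j j + (\<Sum>k\<in>{..<length I} - {j}. delay k j)"
    using j by (simp add: sum.remove)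
  finally show ?thesis .
qed

text \<open>If the execution starts from the queue, the job's own test is among its predecessors. It
  adds \<open>t j / m\<close> to the start, at most the \<open>t j\<close> contained in
  \<open>run_time\<close>. If the execution follows the test directly, the start of the test is
  bounded instead.\<close>

lemma completion_time_le:
  assumes j: "j < length I"
  shows "completion_time I \<sigma> j \<le> run_time I T j + (\<Sum>k\<in>{..<length I} - {j}. delay k j) / real m"
proof (cases "j \<in> T")
  case False
  then have C: "completion_time I \<sigma> j = start_of \<sigma> (Untested j) + u j"
    using dom by (auto simp: completion_time_def end_of_def all_tasks_def)
  have "delay j j = 0" using delaying_untested(1)[OF j False] by (auto simp: delay_untested[OF False])
  then have "real m * start_of \<sigma> (Untested j) \<le> (\<Sum>k\<in>{..<length I} - {j}. delay k j)"
    using Untested_from_queue[OF j False] sum_delaying[OF j] False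
    by (simp add: started_from_queue_def delaying_def)
  then show ?thesis using m False C by (simp add: run_time_def field_simps)
next
  case True
  then have C: "completion_time I \<sigma> j = start_of \<sigma> (Exec j) + p j"
    using dom by (auto simp: completion_time_def end_of_def all_tasks_def)
  have E: "Exec j \<notin> delaying j" using delaying_tested(1)[OF True] by blast
  show ?thesis
  proof (cases "started_from_queue m \<beta> I \<sigma> ord (Exec j)")
    case q: True
    have "delay j j \<le> t j" using E job_nonneg[OF j] by (simp add: delay_tested[OF True])
    also have "\<dots> \<le> real m * t j" using job_nonneg[OF j] m by simp
    finally have "delay j j \<le> real m * t j" .
    moreover have "delaying j = preds \<sigma> ord (Exec j)" using True q by (simp add: delaying_def)
    ultimately have "real m * start_of \<sigma> (Exec j) \<le> real m * t j + (\<Sum>k\<in>{..<length I} - {j}. delay k j)"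
      using q sum_delaying[OF j] by (simp add: started_from_queue_def)
    then show ?thesis using m True C by (simp add: run_time_def field_simps)
  next
    case q: False
    have D: "delaying j = preds \<sigma> ord (Test j)" using True q by (simp add: delaying_def)
    then have "Test j \<notin> delaying j" by (simp add: preds_def)
    then have "delay j j = 0" using E by (simp add: delay_tested[OF True])
    then have "real m * start_of \<sigma> (Test j) \<le> (\<Sum>k\<in>{..<length I} - {j}. delay k j)"
      using Test_from_queue[OF True] sum_delaying[OF j] unfolding D
      by (simp add: started_from_queue_def)
    then show ?thesis using m True C Exec_not_from_queue[OF True q]
      by (simp add: run_time_def field_simps)
  qed
qed

section \<open>Total cost of a run\<close>

lemma cost_nonneg: "0 \<le> cost I \<sigma>"
  unfolding cost_def
proof (intro sum_nonneg)
  fix j assume "j \<in> {..<length I}"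
  then have j: "j < length I" by simp
  show "0 \<le> completion_time I \<sigma> j"
  proof (cases "j \<in> T")
    case True
    then have "Exec j \<in> dom \<sigma>" unfolding dom all_tasks_def by blast
    then show ?thesis
      using start_nonneg[of "Exec j"] job_nonneg[OF j] by (simp add: completion_time_def end_of_def)
  next
    case False
    then have "Exec j \<notin> dom \<sigma>" "Untested j \<in> dom \<sigma>" using j unfolding dom all_tasks_def by blast+
    then show ?thesis using start_nonneg[of "Untested j"] job_nonneg[OF j]
      by (simp add: completion_time_def end_of_def del: domIff)
  qed
qed

text \<open>Each unordered pair occurs twice among the ordered ones, whence the factor 2 in the
  denominator. The selector \<open>\<kappa>\<close> is left open so that it can be chosen by
  \<open>opt_time\<close>, independently of \<open>T\<close>.\<close>

lemma cost_le:
  fixes \<kappa> :: "nat \<Rightarrow> nat \<Rightarrow> nat"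
  assumes \<kappa>: "\<And>j k. \<kappa> j k \<in> {j, k}"
  shows "cost I \<sigma> \<le> (\<Sum>j<length I. run_time I T j) +
    (\<Sum>j<length I. \<Sum>k\<in>{..<length I} - {j}. pair_bound \<beta> I T (\<kappa> j k)) / (2 * real m)"
proof -
  let ?n = "length I"
  have off: "(\<Sum>j<?n. \<Sum>k\<in>{..<?n} - {j}. f j k) = (\<Sum>j<?n. \<Sum>k<?n. if k = j then 0 else f j k)"
    for f :: "nat \<Rightarrow> nat \<Rightarrow> real"
    by (intro sum.cong[OF refl]) (simp add: sum.remove)
  have "(\<Sum>j<?n. \<Sum>k\<in>{..<?n} - {j}. delay j k) = (\<Sum>j<?n. \<Sum>k\<in>{..<?n} - {j}. delay k j)"
    unfolding off by (subst sum.swap) (simp add: eq_commute)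
  then have "2 * (\<Sum>j<?n. \<Sum>k\<in>{..<?n} - {j}. delay k j) =
      (\<Sum>j<?n. \<Sum>k\<in>{..<?n} - {j}. delay j k + delay k j)"
    by (simp add: sum.distrib)
  also have "\<dots> \<le> (\<Sum>j<?n. \<Sum>k\<in>{..<?n} - {j}. pair_bound \<beta> I T (\<kappa> j k))"
  proof (intro sum_mono)
    fix j k assume "j \<in> {..<?n}" "k \<in> {..<?n} - {j}"
    then show "delay j k + delay k j \<le> pair_bound \<beta> I T (\<kappa> j k)"
      using delay_pair_le[of j k] delay_pair_le[of k j] \<kappa>[of j k] by auto
  qed
  finally have "(\<Sum>j<?n. \<Sum>k\<in>{..<?n} - {j}. delay k j) / real m \<le>
      (\<Sum>j<?n. \<Sum>k\<in>{..<?n} - {j}. pair_bound \<beta> I T (\<kappa> j k)) / (2 * real m)"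
    using m by (simp add: field_simps)
  moreover have "cost I \<sigma> \<le> (\<Sum>j<?n. run_time I T j + (\<Sum>k\<in>{..<?n} - {j}. delay k j) / real m)"
    unfolding cost_def by (intro sum_mono) (simp add: completion_time_le)
  ultimately show ?thesis by (simp add: sum.distrib sum_divide_distrib)
qed

end

section \<open>Mean busy times\<close>

text \<open>This is Cauchy-Schwarz over \<open>M\<close> for the quadratic form with kernel
  \<open>min\<close>. The form is a nonnegative combination of squares of sums, found by repeatedly
  splitting off the smallest weight; each square is treated separately.\<close>

lemma sum_square_min_le:
  fixes L :: "'i \<Rightarrow> 'a \<Rightarrow> real" and w :: "'a \<Rightarrow> real"
  assumes "finite S" "\<And>j. j \<in> S \<Longrightarrow> 0 \<le> w j"
  shows "(\<Sum>j\<in>S. \<Sum>k\<in>S. (\<Sum>i\<in>M. L i j) * (\<Sum>i\<in>M. L i k) * min (w j) (w k))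
     \<le> real (card M) * (\<Sum>i\<in>M. \<Sum>j\<in>S. \<Sum>k\<in>S. L i j * L i k * min (w j) (w k))"
  using assms
proof (induction "card S" arbitrary: S w rule: less_induct)
  case less
  show ?case
  proof (cases "S = {}")
    case False
    define v where "v = Min (w ` S)"
    have "v \<in> w ` S" unfolding v_def using False less.prems(1) by (intro Min_in) auto
    then obtain a where a: "a \<in> S" "w a = v" by auto
    have v: "v \<le> w j" if "j \<in> S" for j using that less.prems(1) by (simp add: v_def)
    have v0: "v \<ge> 0" using a less.prems(2) by metis
    define S' where "S' = S - {a}"
    have fS': "finite S'" using less.prems(1) by (simp add: S'_def)
    have card: "card S' < card S" unfolding S'_def using less.prems(1) a(1) by (rule card_Diff1_less)
    \<comment> \<open>Subtracting the least weight \<open>v\<close> leaves a kernel of the same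
      kind. It vanishes at \<open>a\<close>, whose new weight is 0, so the index set
      shrinks.\<close>
    have drop: "(\<Sum>j\<in>S. \<Sum>k\<in>S. y j * y k * min (w j) (w k)) =
        (\<Sum>j\<in>S'. \<Sum>k\<in>S'. y j * y k * min (w j - v) (w k - v)) + v * (\<Sum>j\<in>S. y j)\<^sup>2" for y :: "'a \<Rightarrow> real"
    proof -
      have "(\<Sum>j\<in>S. \<Sum>k\<in>S. y j * y k * min (w j) (w k)) =
        (\<Sum>j\<in>S. \<Sum>k\<in>S. y j * y k * min (w j - v) (w k - v) + v * (y j * y k))"
        by (intro sum.cong refl) (simp add: min_def algebra_simps)
      also have "\<dots> = (\<Sum>j\<in>S. \<Sum>k\<in>S. y j * y k * min (w j - v) (w k - v)) + v * (\<Sum>j\<in>S. y j)\<^sup>2"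
        unfolding power2_eq_square sum_product by (simp add: sum.distrib sum_distrib_left)
      also have "(\<Sum>j\<in>S. \<Sum>k\<in>S. y j * y k * min (w j - v) (w k - v)) =
          (\<Sum>j\<in>S. \<Sum>k\<in>S'. y j * y k * min (w j - v) (w k - v))"
        unfolding S'_def using less.prems(1) a v
        by (intro sum.cong[OF refl] sum.mono_neutral_right) auto
      also have "\<dots> = (\<Sum>j\<in>S'. \<Sum>k\<in>S'. y j * y k * min (w j - v) (w k - v))"
        unfolding S'_def using less.prems(1) a v
        by (intro sum.mono_neutral_right) (auto intro!: sum.neutral)
      finally show ?thesis .
    qed
    have IH: "(\<Sum>j\<in>S'. \<Sum>k\<in>S'. (\<Sum>i\<in>M. L i j) * (\<Sum>i\<in>M. L i k) * min (w j - v) (w k - v))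
     \<le> real (card M) * (\<Sum>i\<in>M. \<Sum>j\<in>S'. \<Sum>k\<in>S'. L i j * L i k * min (w j - v) (w k - v))"
      by (rule less.hyps[OF card fS']) (use v in \<open>auto simp: S'_def\<close>)
    have "(\<Sum>j\<in>S. \<Sum>i\<in>M. L i j)\<^sup>2 = (\<Sum>i\<in>M. \<Sum>j\<in>S. L i j)\<^sup>2"
      by (subst sum.swap) (rule refl)
    \<comment> \<open>For infinite \<open>M\<close> the cardinality and all sums over
      \<open>M\<close> are 0 by convention.\<close>
    also have "\<dots> \<le> real (card M) * (\<Sum>i\<in>M. (\<Sum>j\<in>S. L i j)\<^sup>2)"
      using sum_squared_le_sum_of_squares[of "\<lambda>i. \<Sum>j\<in>S. L i j" M]
      by (cases "M = {}"; cases "finite M") (simp_all add: mult.commute)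
    finally have "v * (\<Sum>j\<in>S. \<Sum>i\<in>M. L i j)\<^sup>2 \<le> real (card M) * (\<Sum>i\<in>M. v * (\<Sum>j\<in>S. L i j)\<^sup>2)"
      using mult_left_mono[OF _ v0] by (metis sum_distrib_left mult.left_commute)
    then show ?thesis using IH unfolding drop sum.distrib distrib_left by (rule add_mono[rotated])
  qed simp
qed

text \<open>Induction removing the interval that starts last: all others end by its start. Positive
  lengths matter, as an empty interval could share its start with a longer one.\<close>

lemma sum_disjoint_intervals_le:
  fixes a d :: "'a \<Rightarrow> real"
  assumes "finite S" "\<And>x. x \<in> S \<Longrightarrow> 0 \<le> a x" "\<And>x. x \<in> S \<Longrightarrow> 0 < d x"
    and "\<And>x y. x \<in> S \<Longrightarrow> y \<in> S \<Longrightarrow> x \<noteq> y \<Longrightarrow> a x + d x \<le> a y \<or> a y + d y \<le> a x"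
    and "\<And>x. x \<in> S \<Longrightarrow> a x + d x \<le> e" "0 \<le> e"
  shows "(\<Sum>x\<in>S. d x) \<le> e"
  using assms
proof (induction "card S" arbitrary: S e rule: less_induct)
  case less
  show ?case
  proof (cases "S = {}")
    case False
    define z where "z = arg_min_on (\<lambda>x. - a x) S"
    have z: "z \<in> S" "\<And>x. x \<in> S \<Longrightarrow> a x \<le> a z"
      using arg_min_if_finite(1)[OF less.prems(1) False] arg_min_least[OF less.prems(1) False, of _ "\<lambda>x. - a x"]
      unfolding z_def by auto
    have before: "a x + d x \<le> a z" if "x \<in> S - {z}" for x
      using less.prems(4)[of x z] less.prems(3)[of z] z(1) z(2)[of x] that by auto
    have "(\<Sum>x\<in>S - {z}. d x) \<le> a z"
    proof (rule less.hyps)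
      show "card (S - {z}) < card S" using less.prems(1) z(1) by (rule card_Diff1_less)
    qed (use less.prems(1-4) z(1) before in blast)+
    then show ?thesis
      using less.prems(5)[OF z(1)] sum.remove[OF less.prems(1) z(1), of d] by simp
  qed (use less.prems in simp)
qed

text \<open>Remove the interval \<open>z\<close> that starts last. The others fit before
  \<open>a z\<close>, and \<open>min (w z) (w y) \<le> w z\<close>, so the pairs involving
  \<open>z\<close> contribute at most \<open>d z * w z * (d z + 2 * a z)\<close>, which is the term
  of \<open>z\<close> on the right.\<close>

lemma sum_midpoints_ge_pos:
  fixes a d w :: "'a \<Rightarrow> real"
  assumes "finite S" "\<And>x. x \<in> S \<Longrightarrow> 0 \<le> a x" "\<And>x. x \<in> S \<Longrightarrow> 0 < d x" "\<And>x. x \<in> S \<Longrightarrow> 0 \<le> w x"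
    and "\<And>x y. x \<in> S \<Longrightarrow> y \<in> S \<Longrightarrow> x \<noteq> y \<Longrightarrow> a x + d x \<le> a y \<or> a y + d y \<le> a x"
  shows "(\<Sum>x\<in>S. \<Sum>y\<in>S. d x * d y * min (w x) (w y)) \<le> 2 * (\<Sum>x\<in>S. w x * (d x * (a x + d x / 2)))"
  using assms
proof (induction "card S" arbitrary: S rule: less_induct)
  case less
  show ?case
  proof (cases "S = {}")
    case False
    define z where "z = arg_min_on (\<lambda>x. - a x) S"
    have z: "z \<in> S" "\<And>x. x \<in> S \<Longrightarrow> a x \<le> a z"
      using arg_min_if_finite(1)[OF less.prems(1) False] arg_min_least[OF less.prems(1) False, of _ "\<lambda>x. - a x"]
      unfolding z_def by auto
    define S' where "S' = S - {z}"
    have fin: "finite S'" "z \<notin> S'" and S: "S = insert z S'" using z less.prems(1) by (auto simp: S'_def)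
    have before: "a x + d x \<le> a z" if "x \<in> S'" for x
      using less.prems(5)[of x z] less.prems(3)[of z] z(1) z(2)[of x] that by (auto simp: S'_def)
    have dS': "(\<Sum>x\<in>S'. d x) \<le> a z"
      using less.prems(2,3,5) fin(1) before z(1) unfolding S
      by (intro sum_disjoint_intervals_le[where a = a]) blast+
    have IH: "(\<Sum>x\<in>S'. \<Sum>y\<in>S'. d x * d y * min (w x) (w y)) \<le> 2 * (\<Sum>x\<in>S'. w x * (d x * (a x + d x / 2)))"
    proof (rule less.hyps)
      show "card S' < card S" unfolding S'_def using less.prems(1) z(1) by (rule card_Diff1_less)
    qed (use less.prems(2-5) fin(1) in \<open>unfold S, blast\<close>)+
    have z0: "0 \<le> d z" "0 \<le> w z" using less.prems(3,4) z(1) by (auto simp: less_imp_le)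
    have "(\<Sum>y\<in>S'. d z * d y * min (w z) (w y)) \<le> (\<Sum>y\<in>S'. d z * w z * d y)"
    proof (rule sum_mono)
      fix y assume "y \<in> S'"
      then have "0 \<le> d z * d y" using z0 less.prems(3)[of y] S by simp
      then have "d z * d y * min (w z) (w y) \<le> d z * d y * w z" by (intro mult_left_mono) auto
      then show "d z * d y * min (w z) (w y) \<le> d z * w z * d y" by (simp add: ac_simps)
    qed
    also have "\<dots> = d z * w z * (\<Sum>y\<in>S'. d y)" by (simp add: sum_distrib_left)
    also have "\<dots> \<le> d z * w z * a z" using dS' z0 by (intro mult_left_mono) auto
    finally have cross: "(\<Sum>y\<in>S'. d z * d y * min (w z) (w y)) \<le> d z * w z * a z" .
    have "(\<Sum>x\<in>S. \<Sum>y\<in>S. d x * d y * min (w x) (w y)) = d z * d z * w z +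
        (\<Sum>y\<in>S'. d z * d y * min (w z) (w y)) + (\<Sum>y\<in>S'. d y * d z * min (w y) (w z)) +
        (\<Sum>x\<in>S'. \<Sum>y\<in>S'. d x * d y * min (w x) (w y))"
      unfolding S using fin by (simp add: sum.distrib)
    also have "(\<Sum>y\<in>S'. d y * d z * min (w y) (w z)) = (\<Sum>y\<in>S'. d z * d y * min (w z) (w y))"
      by (intro sum.cong) (auto simp: ac_simps min.commute)
    finally have "(\<Sum>x\<in>S. \<Sum>y\<in>S. d x * d y * min (w x) (w y)) \<le>
        d z * d z * w z + 2 * (d z * w z * a z) + 2 * (\<Sum>x\<in>S'. w x * (d x * (a x + d x / 2)))"
      using cross IH by linarith
    also have "\<dots> = 2 * (\<Sum>x\<in>S. w x * (d x * (a x + d x / 2)))"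
      unfolding S using fin by (simp add: algebra_simps)
    finally show ?thesis .
  qed simp
qed

text \<open>\<open>a x + d x / 2\<close> is the midpoint of the interval in which \<open>x\<close> is run, so that the
  right-hand side is a weighted sum of mean busy times.\<close>

lemma sum_midpoints_ge:
  fixes a d w :: "'a \<Rightarrow> real"
  assumes "finite S" "\<And>x. x \<in> S \<Longrightarrow> 0 \<le> a x" "\<And>x. x \<in> S \<Longrightarrow> 0 \<le> d x" "\<And>x. x \<in> S \<Longrightarrow> 0 \<le> w x"
    and "\<And>x y. x \<in> S \<Longrightarrow> y \<in> S \<Longrightarrow> x \<noteq> y \<Longrightarrow> a x + d x \<le> a y \<or> a y + d y \<le> a x"
  shows "(\<Sum>x\<in>S. \<Sum>y\<in>S. d x * d y * min (w x) (w y)) \<le> 2 * (\<Sum>x\<in>S. w x * (d x * (a x + d x / 2)))"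
proof -
  \<comment> \<open>Intervals of length 0 contribute nothing to either side, which leaves positive
    lengths.\<close>
  define S' where "S' = {x\<in>S. d x \<noteq> 0}"
  have "(\<Sum>x\<in>S. \<Sum>y\<in>S. d x * d y * min (w x) (w y)) = (\<Sum>x\<in>S. \<Sum>y\<in>S'. d x * d y * min (w x) (w y))"
    unfolding S'_def using assms(1) by (intro sum.cong[OF refl] sum.mono_neutral_right) auto
  also have "\<dots> = (\<Sum>x\<in>S'. \<Sum>y\<in>S'. d x * d y * min (w x) (w y))"
    unfolding S'_def using assms(1) by (intro sum.mono_neutral_right) auto
  also have "\<dots> \<le> 2 * (\<Sum>x\<in>S'. w x * (d x * (a x + d x / 2)))"
    using assms by (intro sum_midpoints_ge_pos) (auto simp: S'_def less_le)
  also have "(\<Sum>x\<in>S'. w x * (d x * (a x + d x / 2))) = (\<Sum>x\<in>S. w x * (d x * (a x + d x / 2)))"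
    unfolding S'_def using assms(1) by (intro sum.mono_neutral_left) auto
  finally show ?thesis .
qed

section \<open>Lower bounds on the optimum\<close>

lemma sum_all_tasks:
  fixes f :: "task \<Rightarrow> real"
  assumes "T \<subseteq> {..<length I}"
  shows "(\<Sum>x\<in>all_tasks I T. f x) =
    (\<Sum>j<length I. if j \<in> T then f (Test j) + f (Exec j) else f (Untested j))"
proof -
  have "all_tasks I T = (\<Union>j<length I. job_tasks T j)"
    using assms by (auto simp: all_tasks_def job_tasks_def split: if_splits)
  also have "sum f \<dots> = (\<Sum>j<length I. sum f (job_tasks T j))"
    by (rule sum.UNION_disjoint) (auto simp: job_tasks_def split: if_splits)
  also have "\<dots> = (\<Sum>j<length I. if j \<in> T then f (Test j) + f (Exec j) else f (Untested j))"
    by (intro sum.cong) (auto simp: job_tasks_def)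
  finally show ?thesis .
qed

fun job_of :: "task \<Rightarrow> nat" where
  "job_of (Test j) = j"
| "job_of (Exec j) = j"
| "job_of (Untested j) = j"

text \<open>Splits a sum over jobs into tasks, as the test and the execution of a job may be on
  different machines.\<close>

lemma sum_duration_all_tasks:
  assumes "T \<subseteq> {..<length I}"
  shows "(\<Sum>x\<in>all_tasks I T. duration I x * h (job_of x)) = (\<Sum>j<length I. run_time I T j * h j)"
  unfolding sum_all_tasks[OF assms] by (intro sum.cong) (auto simp: run_time_def algebra_simps)

lemma opt_time_le_run_time: "opt_time (I ! j) \<le> run_time I T j"
  by (simp add: opt_time_def run_time_def)

lemma valid_job_nth: "valid_instance I \<Longrightarrow> j < length I \<Longrightarrow> valid_job (I ! j)"
  by (simp add: valid_instance_def)

lemma opt_time_pos: "valid_job J \<Longrightarrow> 0 < opt_time J"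
  by (simp add: valid_job_def opt_time_def)

lemma run_time_pos: "valid_instance I \<Longrightarrow> j < length I \<Longrightarrow> 0 < run_time I T j"
  using opt_time_pos[OF valid_job_nth] opt_time_le_run_time by (meson less_le_trans)

lemma feasible_scheduleE:
  assumes "feasible_schedule m I \<sigma>"
  obtains T where "T \<subseteq> {..<length I}" "dom \<sigma> = all_tasks I T"
    "\<And>x. x \<in> dom \<sigma> \<Longrightarrow> machine_of \<sigma> x < m \<and> 0 \<le> start_of \<sigma> x"
    "\<And>j. Test j \<in> dom \<sigma> \<Longrightarrow> end_of I \<sigma> (Test j) \<le> start_of \<sigma> (Exec j)"
    "\<And>x y. x \<in> dom \<sigma> \<Longrightarrow> y \<in> dom \<sigma> \<Longrightarrow> x \<noteq> y \<Longrightarrow> machine_of \<sigma> x = machine_of \<sigma> y \<Longrightarrow>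
        end_of I \<sigma> x \<le> start_of \<sigma> y \<or> end_of I \<sigma> y \<le> start_of \<sigma> x"
proof -
  obtain T where "T \<subseteq> {..<length I}" "dom \<sigma> = all_tasks I T"
    using assms unfolding feasible_schedule_def all_tasks_def by meson
  then show ?thesis by (rule that) (use assms in \<open>simp_all add: feasible_schedule_def del: domIff\<close>)
qed

lemma completion_time_feasible:
  assumes "dom \<sigma> = all_tasks I T"
  shows "completion_time I \<sigma> j =
    (if j \<in> T then start_of \<sigma> (Exec j) + proc_time (I ! j)
     else start_of \<sigma> (Untested j) + upper_limit (I ! j))"
proof -
  have "Exec j \<in> dom \<sigma> \<longleftrightarrow> j \<in> T" unfolding assms(1) all_tasks_def by blast
  then show ?thesis by (simp add: completion_time_def end_of_def)
qed

lemma sum_opt_time_le_cost: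
  assumes V: "valid_instance I" and \<sigma>: "feasible_schedule m I \<sigma>"
  shows "(\<Sum>j<length I. opt_time (I ! j)) \<le> cost I \<sigma>"
proof -
  obtain T where T: "T \<subseteq> {..<length I}" and D: "dom \<sigma> = all_tasks I T"
    and nonneg: "\<And>x. x \<in> dom \<sigma> \<Longrightarrow> machine_of \<sigma> x < m \<and> 0 \<le> start_of \<sigma> x"
    and prec: "\<And>j. Test j \<in> dom \<sigma> \<Longrightarrow> end_of I \<sigma> (Test j) \<le> start_of \<sigma> (Exec j)"
    using feasible_scheduleE[OF \<sigma>] by metis
  have "opt_time (I ! j) \<le> completion_time I \<sigma> j" if j: "j < length I" for j
  proof (cases "j \<in> T")
    case True
    then have "Test j \<in> dom \<sigma>" by (simp add: D all_tasks_def)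
    then show ?thesis using nonneg[of "Test j"] prec[of j] opt_time_le_run_time[of I j T] True
      by (simp add: completion_time_feasible[OF D] run_time_def end_of_def)
  next
    case False
    then have "Untested j \<in> dom \<sigma>" using j by (simp add: D all_tasks_def)
    then show ?thesis using nonneg[of "Untested j"] opt_time_le_run_time[of I j T] False
      by (simp add: completion_time_feasible[OF D] run_time_def)
  qed
  then show ?thesis unfolding cost_def by (intro sum_mono) simp
qed

text \<open>Let \<open>P j\<close> be the time spent on \<open>j\<close>. With weight
  \<open>1 / P j\<close> on its tasks, the weighted midpoints add up to the mean busy time of
  \<open>j\<close>, and \<open>P j * P k * min (1 / P j) (1 / P k)\<close> is
  \<open>min (P j) (P k)\<close>. \<open>sum_midpoints_ge\<close> treats one machine,
  \<open>sum_square_min_le\<close> combines the machines.\<close>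

lemma sum_min_opt_time_le_cost:
  assumes V: "valid_instance I" and \<sigma>: "feasible_schedule m I \<sigma>"
  shows "(\<Sum>j<length I. \<Sum>k<length I. min (opt_time (I ! j)) (opt_time (I ! k))) +
     real m * (\<Sum>j<length I. opt_time (I ! j)) \<le> 2 * real m * cost I \<sigma>"
proof -
  obtain T where T: "T \<subseteq> {..<length I}" and D: "dom \<sigma> = all_tasks I T"
    and nonneg: "\<And>x. x \<in> dom \<sigma> \<Longrightarrow> machine_of \<sigma> x < m \<and> 0 \<le> start_of \<sigma> x"
    and prec: "\<And>j. Test j \<in> dom \<sigma> \<Longrightarrow> end_of I \<sigma> (Test j) \<le> start_of \<sigma> (Exec j)"
    and disj: "\<And>x y. x \<in> dom \<sigma> \<Longrightarrow> y \<in> dom \<sigma> \<Longrightarrow> x \<noteq> y \<Longrightarrow> machine_of \<sigma> x = machine_of \<sigma> y \<Longrightarrow>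
        end_of I \<sigma> x \<le> start_of \<sigma> y \<or> end_of I \<sigma> y \<le> start_of \<sigma> x"
    using feasible_scheduleE[OF \<sigma>] by metis
  define S where "S = all_tasks I T"
  define P where "P = run_time I T"
  define d where "d = duration I"
  define a where "a = start_of \<sigma>"
  define w where "w x = 1 / P (job_of x)" for x
  have P: "0 < P j" if "j < length I" for j using run_time_pos[OF V that] by (simp add: P_def)
  have finS: "finite S" unfolding S_def by (rule finite_all_tasks[OF T])
  have job: "job_of x < length I" if "x \<in> S" for x
    using that T by (auto simp: S_def all_tasks_def)
  have w: "0 \<le> w x" if "x \<in> S" for x using P[OF job[OF that]] by (simp add: w_def)
  have d: "0 \<le> d x" if "x \<in> S" for x using duration_nonneg[OF V T] that by (simp add: S_def d_def)

  define L where "L i x = (if machine_of \<sigma> x = i then d x else 0)" for i x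
  define K where "K i = {x \<in> S. machine_of \<sigma> x = i}" for i
  have L_sum: "(\<Sum>i<m. L i x) = d x" if "x \<in> S" for x
    using nonneg[of x] that by (simp add: L_def D S_def)
  have K_sum: "(\<Sum>x\<in>S. \<Sum>y\<in>S. L i x * L i y * min (w x) (w y)) \<le>
      2 * (\<Sum>x\<in>K i. w x * (d x * (a x + d x / 2)))" for i
  proof -
    have "(\<Sum>x\<in>S. \<Sum>y\<in>S. L i x * L i y * min (w x) (w y)) =
        (\<Sum>x\<in>S. \<Sum>y\<in>K i. L i x * L i y * min (w x) (w y))"
      unfolding K_def L_def using finS by (intro sum.cong[OF refl] sum.mono_neutral_right) auto
    also have "\<dots> = (\<Sum>x\<in>K i. \<Sum>y\<in>K i. L i x * L i y * min (w x) (w y))"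
      unfolding K_def L_def using finS by (intro sum.mono_neutral_right) auto
    also have "\<dots> = (\<Sum>x\<in>K i. \<Sum>y\<in>K i. d x * d y * min (w x) (w y))"
      by (intro sum.cong) (auto simp: K_def L_def)
    also have "\<dots> \<le> 2 * (\<Sum>x\<in>K i. w x * (d x * (a x + d x / 2)))"
    proof (rule sum_midpoints_ge)
      show "finite (K i)" using finS by (simp add: K_def)
      fix x assume x: "x \<in> K i"
      then have "x \<in> S" by (simp add: K_def)
      then show "0 \<le> a x" "0 \<le> d x" "0 \<le> w x"
        using nonneg[of x] d w by (auto simp: a_def D S_def)
      fix y assume "y \<in> K i" "x \<noteq> y"
      then show "a x + d x \<le> a y \<or> a y + d y \<le> a x"
        using disj[of x y] x by (simp add: K_def D S_def a_def d_def end_of_def)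
    qed
    finally show ?thesis .
  qed
  \<comment> \<open>For a given completion time, the mean busy time is largest if the job runs
    contiguously up to its completion.\<close>
  have mean: "(\<Sum>x\<in>S. w x * (d x * (a x + d x / 2))) \<le> (\<Sum>j<length I. completion_time I \<sigma> j - P j / 2)"
    unfolding S_def sum_all_tasks[OF T]
  proof (rule sum_mono)
    fix j assume "j \<in> {..<length I}"
    then have j: "j < length I" by simp
    show "(if j \<in> T then w (Test j) * (d (Test j) * (a (Test j) + d (Test j) / 2)) +
          w (Exec j) * (d (Exec j) * (a (Exec j) + d (Exec j) / 2))
        else w (Untested j) * (d (Untested j) * (a (Untested j) + d (Untested j) / 2)))
        \<le> completion_time I \<sigma> j - P j / 2"
    proof (cases "j \<in> T")
      case False
      then show ?thesis using P[OF j]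
        by (simp add: completion_time_feasible[OF D] w_def P_def d_def a_def run_time_def field_simps)
    next
      case True
      define t p where "t = test_time (I ! j)" and "p = proc_time (I ! j)"
      have "Test j \<in> dom \<sigma>" using True by (simp add: D all_tasks_def)
      then have "a (Test j) + t \<le> a (Exec j)" using prec[of j] by (simp add: end_of_def a_def t_def)
      moreover have t: "0 < t" using valid_job_nth[OF V j] by (simp add: valid_job_def t_def)
      \<comment> \<open>\<open>a (Exec j) - t / 2\<close> is the midpoint of a test that ends just
        as the execution begins.\<close>
      ultimately have "t * (a (Test j) + t / 2) \<le> t * (a (Exec j) - t / 2)"
        by (intro mult_left_mono) auto
      then have "t * (a (Test j) + t / 2) + p * (a (Exec j) + p / 2) \<le>
          (t + p) * (a (Exec j) + p - (t + p) / 2)"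
        by (simp add: field_simps)
      moreover have tp: "P j = t + p" using True by (simp add: P_def run_time_def t_def p_def)
      ultimately have "(t * (a (Test j) + t / 2) + p * (a (Exec j) + p / 2)) / P j \<le>
          a (Exec j) + p - P j / 2"
        using P[OF j] by (simp add: divide_le_eq mult.commute)
      then show ?thesis using True
        by (simp add: completion_time_feasible[OF D] w_def d_def add_divide_distrib a_def
            flip: t_def p_def)
    qed
  qed
  have "(\<Sum>j<length I. \<Sum>k<length I. min (P j) (P k)) = (\<Sum>j<length I. \<Sum>k<length I. P j * P k * min (1 / P j) (1 / P k))"
  proof (intro sum.cong refl)
    fix j k assume "j \<in> {..<length I}" "k \<in> {..<length I}"
    then show "min (P j) (P k) = P j * P k * min (1 / P j) (1 / P k)"
      using P[of j] P[of k] by (auto simp: min_def field_simps)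
  qed
  also have "\<dots> = (\<Sum>j<length I. P j * (\<Sum>k<length I. P k * min (1 / P j) (1 / P k)))"
    by (simp add: sum_distrib_left mult.assoc)
  also have "\<dots> = (\<Sum>x\<in>S. d x * (\<Sum>y\<in>S. d y * min (w x) (w y)))"
    unfolding S_def d_def w_def P_def
    by (subst (1 2) sum_duration_all_tasks[OF T, symmetric]) (rule refl)
  also have "\<dots> = (\<Sum>x\<in>S. \<Sum>y\<in>S. (\<Sum>i<m. L i x) * (\<Sum>i<m. L i y) * min (w x) (w y))"
    by (intro sum.cong refl, subst sum_distrib_left, intro sum.cong refl) (simp add: L_sum)
  also have "\<dots> \<le> real m * (\<Sum>i<m. \<Sum>x\<in>S. \<Sum>y\<in>S. L i x * L i y * min (w x) (w y))"
    using sum_square_min_le[OF finS w, where M = "{..<m}" and L = L] by simp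
  also have "\<dots> \<le> real m * (\<Sum>i<m. 2 * (\<Sum>x\<in>K i. w x * (d x * (a x + d x / 2))))"
    by (intro mult_left_mono sum_mono K_sum) simp
  also have "(\<Sum>i<m. 2 * (\<Sum>x\<in>K i. w x * (d x * (a x + d x / 2)))) =
      2 * (\<Sum>x\<in>(\<Union>i<m. K i). w x * (d x * (a x + d x / 2)))"
    using finS by (subst sum.UNION_disjoint) (auto simp: K_def sum_distrib_left)
  also have "(\<Union>i<m. K i) = S" using nonneg by (auto simp: K_def D S_def)
  also have "real m * (2 * (\<Sum>x\<in>S. w x * (d x * (a x + d x / 2)))) \<le>
      real m * (2 * (\<Sum>j<length I. completion_time I \<sigma> j - P j / 2))"
    using mean by (intro mult_left_mono) auto
  also have "\<dots> = 2 * real m * cost I \<sigma> - real m * (\<Sum>j<length I. P j)"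
    by (simp add: cost_def sum_subtractf sum_divide_distrib[symmetric] algebra_simps)
  finally have "(\<Sum>j<length I. \<Sum>k<length I. min (P j) (P k)) + real m * (\<Sum>j<length I. P j) \<le> 2 * real m * cost I \<sigma>"
    by simp
  \<comment> \<open>The times spent by this particular schedule are now replaced by the smaller
    \<open>opt_time\<close>, which only decreases the left-hand side.\<close>
  moreover have "(\<Sum>j<length I. \<Sum>k<length I. min (opt_time (I ! j)) (opt_time (I ! k))) \<le>
      (\<Sum>j<length I. \<Sum>k<length I. min (P j) (P k))"
    unfolding P_def by (intro sum_mono min.mono opt_time_le_run_time)
  moreover have "real m * (\<Sum>j<length I. opt_time (I ! j)) \<le> real m * (\<Sum>j<length I. P j)"
    unfolding P_def by (intro mult_left_mono sum_mono opt_time_le_run_time) simp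
  ultimately show ?thesis by linarith
qed

text \<open>Makes the infimum in \<open>opt_cost\<close> range over a nonempty set. The witness runs
  all jobs untested on machine 0, in list order.\<close>

lemma feasible_schedule_exists:
  assumes V: "valid_instance I" and "1 \<le> m"
  shows "\<exists>\<sigma>. feasible_schedule m I \<sigma>"
proof -
  define c where "c j = (\<Sum>k<j. upper_limit (I ! k))" for j
  define \<sigma> :: schedule where "\<sigma> x = (case x of Untested j \<Rightarrow> if j < length I then Some (0, c j) else None | _ \<Rightarrow> None)" for x
  have u: "0 < upper_limit (I ! j)" if "j < length I" for j
    using valid_job_nth[OF V that] by (simp add: valid_job_def)
  have "x \<in> dom \<sigma> \<longleftrightarrow> x \<in> Untested ` {..<length I}" for x
    by (cases x) (auto simp: \<sigma>_def split: if_splits)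
  then have D: "dom \<sigma> = Untested ` {..<length I}" by blast
  have S: "machine_of \<sigma> (Untested j) = 0" "start_of \<sigma> (Untested j) = c j" if "j < length I" for j
    using that by (auto simp: \<sigma>_def machine_of_def start_of_def)
  have c: "0 \<le> c j" if "j < length I" for j
    unfolding c_def using u that by (intro sum_nonneg) (meson lessThan_iff less_imp_le less_trans)
  have "c j + upper_limit (I ! j) \<le> c k" if "j < k" "k < length I" for j k
  proof -
    have "c j + upper_limit (I ! j) = (\<Sum>k<Suc j. upper_limit (I ! k))" by (simp add: c_def)
    also have "\<dots> \<le> c k" unfolding c_def
      using that u by (intro sum_mono2) (auto intro: less_imp_le)
    finally show ?thesis .
  qed
  then have "c j + upper_limit (I ! j) \<le> c k \<or> c k + upper_limit (I ! k) \<le> c j"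
    if "j \<noteq> k" "j < length I" "k < length I" for j k
    using that by (meson nat_neq_iff)
  then have "feasible_schedule m I \<sigma>"
    unfolding feasible_schedule_def D using assms(2)
    by (intro conjI exI[of _ "{}"]) (auto simp: S c end_of_def)
  then show ?thesis by blast
qed

lemma opt_cost_ge:
  assumes "valid_instance I" "1 \<le> m" "\<And>\<sigma>. feasible_schedule m I \<sigma> \<Longrightarrow> b \<le> cost I \<sigma>"
  shows "b \<le> opt_cost m I"
  unfolding opt_cost_def using feasible_schedule_exists[OF assms(1,2)] assms(3)
  by (intro cINF_greatest) auto

lemma opt_cost_ge_sum_opt_time:
  assumes "valid_instance I" "1 \<le> m"
  shows "(\<Sum>j<length I. opt_time (I ! j)) \<le> opt_cost m I"
  using assms sum_opt_time_le_cost by (intro opt_cost_ge)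

text \<open>The diagonal terms of the double sum add up to the sum of \<open>opt_time\<close>; after
  division by \<open>2 * real m\<close> they account for the summand \<open>1 / (2 * real m)\<close>
  in its coefficient.\<close>

lemma opt_cost_ge_sum_min:
  assumes "valid_instance I" "1 \<le> m"
  shows "(\<Sum>j<length I. \<Sum>k\<in>{..<length I} - {j}. min (opt_time (I ! j)) (opt_time (I ! k))) / (2 * real m) +
    (1 / 2 + 1 / (2 * real m)) * (\<Sum>j<length I. opt_time (I ! j)) \<le> opt_cost m I"
proof (rule opt_cost_ge[OF assms])
  fix \<sigma> assume \<sigma>: "feasible_schedule m I \<sigma>"
  let ?X = "\<Sum>j<length I. opt_time (I ! j)"
  let ?Y = "\<Sum>j<length I. \<Sum>k\<in>{..<length I} - {j}. min (opt_time (I ! j)) (opt_time (I ! k))"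
  have "(\<Sum>j<length I. \<Sum>k<length I. min (opt_time (I ! j)) (opt_time (I ! k))) = ?X + ?Y"
    by (simp add: sum.remove flip: sum.distrib)
  then have "?X + ?Y + real m * ?X \<le> 2 * real m * cost I \<sigma>"
    using sum_min_opt_time_le_cost[OF assms(1) \<sigma>] by simp
  then have "(?X + ?Y + real m * ?X) / (2 * real m) \<le> cost I \<sigma>"
    using assms(2) by (simp add: divide_le_eq mult.commute)
  moreover have "?Y / (2 * real m) + (1 / 2 + 1 / (2 * real m)) * ?X = (?X + ?Y + real m * ?X) / (2 * real m)"
    using assms(2) by (simp add: add_divide_distrib distrib_right)
  ultimately show "?Y / (2 * real m) + (1 / 2 + 1 / (2 * real m)) * ?X \<le> cost I \<sigma>" by simp
qed

section \<open>Expected cost\<close>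

lemma tested_jobs_subset:
  assumes "T \<in> set_pmf (tested_jobs P I)"
  shows "T \<subseteq> {..<length I}"
proof -
  obtain f where "T = Collect f"
    and "f \<in> set_pmf (Pi_pmf {..<length I} False (\<lambda>j. bernoulli_pmf (job_prob P (I ! j))))"
    using assms unfolding tested_jobs_def set_map_pmf by blast
  then show ?thesis using set_Pi_pmf_subset[of "{..<length I}" False] by blast
qed

lemma finite_set_tested_jobs: "finite (set_pmf (tested_jobs P I))"
proof (rule finite_subset)
  show "set_pmf (tested_jobs P I) \<subseteq> Pow {..<length I}" using tested_jobs_subset by blast
qed simp

lemma expectation_tested_jobs:
  fixes a b :: real
  assumes j: "j < length I" and q: "0 \<le> job_prob P (I ! j)" "job_prob P (I ! j) \<le> 1"
  shows "measure_pmf.expectation (tested_jobs P I) (\<lambda>T. if j \<in> T then a else b) =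
    a * job_prob P (I ! j) + b * (1 - job_prob P (I ! j))"
proof -
  let ?p = "Pi_pmf {..<length I} False (\<lambda>j. bernoulli_pmf (job_prob P (I ! j)))"
  have "measure_pmf.expectation (tested_jobs P I) (\<lambda>T. if j \<in> T then a else b) =
      measure_pmf.expectation (map_pmf (\<lambda>f. f j) ?p) (\<lambda>x. if x then a else b)"
    by (simp add: tested_jobs_def)
  then show ?thesis using j q by (simp add: Pi_pmf_component)
qed

text \<open>The distributions \<open>K x\<close> may have infinite support, so the argument goes
  through the nonnegative integral, which can be iterated without an integrability
  condition.\<close>

lemma expectation_bind_pmf_le:
  fixes h :: "'b \<Rightarrow> real" and B :: "'a \<Rightarrow> real"
  assumes fin: "finite (set_pmf M)"
    and nonneg: "\<And>x y. x \<in> set_pmf M \<Longrightarrow> y \<in> set_pmf (K x) \<Longrightarrow> 0 \<le> h y"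
    and le: "\<And>x y. x \<in> set_pmf M \<Longrightarrow> y \<in> set_pmf (K x) \<Longrightarrow> h y \<le> B x"
  shows "measure_pmf.expectation (bind_pmf M K) h \<le> measure_pmf.expectation M B"
proof -
  have B: "0 \<le> B x" if "x \<in> set_pmf M" for x
    using nonneg[OF that] le[OF that] set_pmf_not_empty[of "K x"] by (meson equals0I order_trans)
  have "(\<integral>\<^sup>+y. ennreal (h y) \<partial>bind_pmf M K) = (\<integral>\<^sup>+x. \<integral>\<^sup>+y. ennreal (h y) \<partial>K x \<partial>M)"
    by simp
  also have "\<dots> \<le> (\<integral>\<^sup>+x. ennreal (B x) \<partial>M)"
  proof (intro nn_integral_mono_AE AE_pmfI)
    fix x assume x: "x \<in> set_pmf M"
    have "(\<integral>\<^sup>+y. ennreal (h y) \<partial>K x) \<le> (\<integral>\<^sup>+y. ennreal (B x) \<partial>K x)"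
      by (intro nn_integral_mono_AE AE_pmfI ennreal_leI le[OF x])
    then show "(\<integral>\<^sup>+y. ennreal (h y) \<partial>K x) \<le> ennreal (B x)" by simp
  qed
  also have "\<dots> = ennreal (measure_pmf.expectation M B)"
    using B by (intro nn_integral_eq_integral integrable_measure_pmf_finite fin AE_pmfI)
  finally have "(\<integral>\<^sup>+y. ennreal (h y) \<partial>bind_pmf M K) \<le> ennreal (measure_pmf.expectation M B)" .
  moreover have "measure_pmf.expectation (bind_pmf M K) h = enn2real (\<integral>\<^sup>+y. ennreal (h y) \<partial>bind_pmf M K)"
    using nonneg by (intro integral_eq_nn_integral AE_pmfI) auto
  moreover have "0 \<le> measure_pmf.expectation M B"
    using B by (intro integral_nonneg_AE AE_pmfI)
  ultimately show ?thesis using enn2real_leI by simp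
qed

section \<open>The ratios of a single job\<close>

lemma r_ratio_mult_opt_time:
  assumes "valid_job J"
  shows "r_ratio P J * opt_time J = (test_time J + proc_time J) * job_prob P J +
    upper_limit J * (1 - job_prob P J)"
  using opt_time_pos[OF assms] by (simp add: r_ratio_def Let_def)

lemma R_ratio_mult_opt_time:
  assumes "valid_job J"
  shows "R_ratio \<beta> P J * opt_time J =
    Max {2 * test_time J + proc_time J, \<beta> * test_time J, (1 + 1 / \<beta>) * (test_time J + proc_time J)} *
      job_prob P J + (1 + 1 / \<beta>) * upper_limit J * (1 - job_prob P J)"
  using opt_time_pos[OF assms] by (simp add: R_ratio_def Let_def)

lemma ratio_bounds:
  assumes "testing_probability P" "0 < \<beta>" "valid_job J"
  shows "0 \<le> r_ratio P J" "r_ratio P J \<le> R_ratio \<beta> P J"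
proof -
  let ?t = "test_time J" and ?u = "upper_limit J" and ?p = "proc_time J" and ?q = "job_prob P J"
  have J: "0 < ?t" "0 < ?u" "0 \<le> ?p" using assms(3) by (auto simp: valid_job_def)
  have q: "0 \<le> ?q" "?q \<le> 1" using assms(1) J by (auto simp: testing_probability_def)
  have "x \<le> (1 + 1 / \<beta>) * x" if "0 \<le> x" for x
    using that assms(2) by (simp add: distrib_right)
  moreover from this have "?t + ?p \<le> Max {2 * ?t + ?p, \<beta> * ?t, (1 + 1 / \<beta>) * (?t + ?p)}"
    using J by simp
  ultimately have "?u * (1 - ?q) + (?t + ?p) * ?q \<le> (1 + 1 / \<beta>) * ?u * (1 - ?q) +
      Max {2 * ?t + ?p, \<beta> * ?t, (1 + 1 / \<beta>) * (?t + ?p)} * ?q"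
    using J q by (intro add_mono mult_right_mono) (auto simp: less_imp_le)
  then show "r_ratio P J \<le> R_ratio \<beta> P J"
    unfolding r_ratio_def R_ratio_def Let_def using opt_time_pos[OF assms(3)] by (intro divide_right_mono) auto
  show "0 \<le> r_ratio P J"
    unfolding r_ratio_def Let_def using opt_time_pos[OF assms(3)] J q by auto
qed

lemma RPCPM_expected_cost_le:
  assumes m: "1 \<le> m" and \<beta>: "0 < \<beta>" and P: "testing_probability P" and A: "is_RPCPM m \<beta> P A"
    and V: "valid_instance I"
    and R: "\<And>J. valid_job J \<Longrightarrow> R_ratio \<beta> P J \<le> R"
    and r: "\<And>J. valid_job J \<Longrightarrow> r_ratio P J \<le> r"
  shows "measure_pmf.expectation (A I) (cost I) \<le> r * (\<Sum>j<length I. opt_time (I ! j)) +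
    R * ((\<Sum>j<length I. \<Sum>k\<in>{..<length I} - {j}. min (opt_time (I ! j)) (opt_time (I ! k))) / (2 * real m))"
proof -
  \<comment> \<open>Each pair is charged to the job with the smaller \<open>opt_time\<close>, so
    that its expected bound is at most \<open>R\<close> times the minimum in the lower bound on the
    optimum.\<close>
  define \<kappa> where "\<kappa> j k = (if opt_time (I ! j) \<le> opt_time (I ! k) then j else k)" for j k
  define B where "B T = (\<Sum>j<length I. run_time I T j) +
    (\<Sum>j<length I. \<Sum>k\<in>{..<length I} - {j}. pair_bound \<beta> I T (\<kappa> j k)) / (2 * real m)" for T
  obtain K where K: "\<And>T. T \<in> set_pmf (tested_jobs P I) \<Longrightarrow> set_pmf (K T) \<subseteq> RPCPM_schedules m \<beta> I T"
    and AI: "A I = bind_pmf (tested_jobs P I) K"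
    using A V unfolding is_RPCPM_def by blast
  have bound: "0 \<le> cost I \<sigma> \<and> cost I \<sigma> \<le> B T"
    if "T \<in> set_pmf (tested_jobs P I)" "\<sigma> \<in> set_pmf (K T)" for T \<sigma>
  proof -
    have T: "T \<subseteq> {..<length I}" using tested_jobs_subset that(1) .
    have "\<sigma> \<in> RPCPM_schedules m \<beta> I T" using K[OF that(1)] that(2) by blast
    then obtain ord where "dom \<sigma> = all_tasks I T" "greedy_order m \<beta> I \<sigma> ord"
      by (rule RPCPM_schedule_greedy[OF m V T])
    then interpret greedy_schedule m \<beta> I T \<sigma> ord
      by unfold_locales (use m \<beta> V T in auto)
    show ?thesis using cost_nonneg cost_le[of \<kappa>] by (simp add: B_def \<kappa>_def)
  qed
  have valid: "valid_job (I ! j)" if "j < length I" for j using valid_job_nth[OF V that] .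
  have q: "0 \<le> job_prob P (I ! j)" "job_prob P (I ! j) \<le> 1" if "j < length I" for j
    using P valid[OF that] by (auto simp: testing_probability_def valid_job_def)
  have integrable: "integrable (tested_jobs P I) f" for f :: "nat set \<Rightarrow> real"
    by (rule integrable_measure_pmf_finite[OF finite_set_tested_jobs])
  have run: "measure_pmf.expectation (tested_jobs P I) (\<lambda>T. run_time I T j) \<le> r * opt_time (I ! j)"
    if "j < length I" for j
    unfolding run_time_def expectation_tested_jobs[where I = I and P = P, OF that q[OF that]]
      r_ratio_mult_opt_time[OF valid[OF that], symmetric]
    using r[OF valid[OF that]] opt_time_pos[OF valid[OF that]] by (simp add: mult_right_mono)
  have pair: "measure_pmf.expectation (tested_jobs P I) (\<lambda>T. pair_bound \<beta> I T j) \<le> R * opt_time (I ! j)"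
    if "j < length I" for j
    unfolding pair_bound_def Let_def expectation_tested_jobs[where I = I and P = P, OF that q[OF that]]
      R_ratio_mult_opt_time[OF valid[OF that], symmetric]
    using R[OF valid[OF that]] opt_time_pos[OF valid[OF that]] by (simp add: mult_right_mono)
  have "measure_pmf.expectation (A I) (cost I) \<le> measure_pmf.expectation (tested_jobs P I) B"
    unfolding AI using bound by (intro expectation_bind_pmf_le finite_set_tested_jobs) auto
  also have "\<dots> = (\<Sum>j<length I. measure_pmf.expectation (tested_jobs P I) (\<lambda>T. run_time I T j)) +
      (\<Sum>j<length I. \<Sum>k\<in>{..<length I} - {j}.
        measure_pmf.expectation (tested_jobs P I) (\<lambda>T. pair_bound \<beta> I T (\<kappa> j k))) / (2 * real m)"
    unfolding B_def by (simp add: integrable)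
  also have "\<dots> \<le> (\<Sum>j<length I. r * opt_time (I ! j)) +
      (\<Sum>j<length I. \<Sum>k\<in>{..<length I} - {j}. R * min (opt_time (I ! j)) (opt_time (I ! k))) / (2 * real m)"
  proof (intro add_mono sum_mono divide_right_mono)
    fix j k assume "j \<in> {..<length I}" "k \<in> {..<length I} - {j}"
    then have "\<kappa> j k < length I" "opt_time (I ! \<kappa> j k) = min (opt_time (I ! j)) (opt_time (I ! k))"
      by (auto simp: \<kappa>_def)
    then show "measure_pmf.expectation (tested_jobs P I) (\<lambda>T. pair_bound \<beta> I T (\<kappa> j k)) \<le>
        R * min (opt_time (I ! j)) (opt_time (I ! k))" using pair by metis
  qed (use run in auto)
  finally show ?thesis by (simp add: sum_distrib_left)
qed

theorem theorem24:
  fixes m :: nat and \<beta> R r :: real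
    and P :: "real \<Rightarrow> real \<Rightarrow> real"
    and A :: "jobs \<Rightarrow> schedule pmf"
  assumes "m \<ge> 1" and "\<beta> > 0"
    and "testing_probability P"
    and "is_RPCPM m \<beta> P A"
    and "bdd_above (R_ratio \<beta> P ` {J. valid_job J})"
    and "bdd_above (r_ratio P ` {J. valid_job J})"
    and "R = (SUP J \<in> {J. valid_job J}. R_ratio \<beta> P J)"
    and "r = (SUP J \<in> {J. valid_job J}. r_ratio P J)"
    and "R \<le> 2 * r"
  shows "expected_competitive_ratio m A
           \<le> ereal (R * (1 / 2 + 1 / (2 * real m)) + r * (1 - 1 / real m))"
proof -
  have R: "R_ratio \<beta> P J \<le> R" if "valid_job J" for J
    unfolding assms(7) using that assms(5) by (intro cSUP_upper) auto
  have r: "r_ratio P J \<le> r" if "valid_job J" for J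
    unfolding assms(8) using that assms(6) by (intro cSUP_upper) auto
  \<comment> \<open>Any valid job serves: it makes the suprema range over a nonempty set and yields
    \<open>0 \<le> R\<close>.\<close>
  have ne: "valid_job \<lparr>test_time = 1, upper_limit = 1, proc_time = 0\<rparr>" by (simp add: valid_job_def)
  have "r \<le> R"
    unfolding assms(8) using ne ratio_bounds(2)[OF assms(3,2)] R by (intro cSUP_least) (auto intro: order_trans)
  have "0 \<le> R" using ratio_bounds[OF assms(3,2) ne] R[OF ne] by linarith
  have "measure_pmf.expectation (A I) (cost I) \<le>
      (R * (1 / 2 + 1 / (2 * real m)) + r * (1 - 1 / real m)) * opt_cost m I" if V: "valid_instance I" for I
  proof -
    define X where "X = (\<Sum>j<length I. opt_time (I ! j))"
    define Y where "Y = (\<Sum>j<length I. \<Sum>k\<in>{..<length I} - {j}. min (opt_time (I ! j)) (opt_time (I ! k))) / (2 * real m)"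
    define h where "h = 1 / real m"
    have h: "0 \<le> h" "h \<le> 1" and h2: "h / 2 = 1 / (2 * real m)"
      using assms(1) by (auto simp: h_def)
    have *: "measure_pmf.expectation (A I) (cost I) \<le> r * X + R * Y"
      unfolding X_def Y_def using RPCPM_expected_cost_le[OF assms(1-4) V R r] .
    have "Y \<le> opt_cost m I - (1 / 2 + h / 2) * X"
      using opt_cost_ge_sum_min[OF V assms(1)] by (simp add: X_def Y_def h_def le_diff_eq ac_simps)
    then have **: "r * X + R * Y \<le> r * X + R * (opt_cost m I - (1 / 2 + h / 2) * X)"
      using \<open>0 \<le> R\<close> by (simp add: mult_left_mono)
    have "measure_pmf.expectation (A I) (cost I) \<le> r * X + R * (opt_cost m I - (1 / 2 + h / 2) * X)"
      using * ** by (rule order_trans)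
    also have "r * X + R * (opt_cost m I - (1 / 2 + h / 2) * X) =
        R * opt_cost m I + (1 - h) * ((r - R / 2) * X) - h * ((R - r) * X)"
      by (simp add: field_simps)
    also have "\<dots> \<le> R * opt_cost m I + (1 - h) * ((r - R / 2) * opt_cost m I)"
    proof -
      have "X \<le> opt_cost m I" unfolding X_def by (rule opt_cost_ge_sum_opt_time[OF V assms(1)])
      then have "(1 - h) * ((r - R / 2) * X) \<le> (1 - h) * ((r - R / 2) * opt_cost m I)"
        using h assms(9) by (intro mult_left_mono) auto
      moreover have "0 \<le> X"
        unfolding X_def using opt_time_pos[OF valid_job_nth[OF V]] by (intro sum_nonneg) (simp add: less_imp_le)
      then have "0 \<le> h * ((R - r) * X)" using h \<open>r \<le> R\<close> by simp
      moreover have "z + a - c \<le> z + b" if "a \<le> b" "0 \<le> c" for a b c z :: real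
        using that by linarith
      ultimately show ?thesis by blast
    qed
    also have "\<dots> = (R * (1 / 2 + h / 2) + r * (1 - h)) * opt_cost m I"
      by (simp add: field_simps)
    finally show ?thesis unfolding h2 unfolding h_def .
  qed
  then show ?thesis unfolding expected_competitive_ratio_def by (intro Inf_lower) auto
qed

end
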